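(* Let $G$ be a chordal graph with a vertex $x_1$ such that $N[x_1]=\{x_1,\dots,x_r\}$ induces a clique in $G$. For each $t=1,\dots,r$ let $H_t=G\setminus N[x_t]$ be the graph obtained from $G$ by removing the closed neighborhood of $x_t$. Then for all $i\geq 1$, $$b_i(J(G)) =\sum_{t=1}^{r}b_i(J(H_t))+\sum_{t=2}^{r}b_{i-1}(J(H_t)),$$ where, if a graph $H$ has no edges, one sets $b_0(J(H))=1$ and $b_p(J(H))=0$ for any $p\neq 0$.
   Context: All graphs are finite and simple. $N(v)$ is the set of neighbors of a vertex $v$ and $N[v]=N(v)\cup\{v\}$; all neighborhoods here are taken in $G$. For $A\subseteq V(G)$, $G\setminus A$ is the induced subgraph obtained by removing the vertices in $A$. A graph is chordal if it has no induced cycle of length greater than $3$. The vertices of a graph are identified with the variables of a polynomial ring $S=\Bbbk[x_1,\dots,x_n]$ over a field $\Bbbk$. A vertex cover of a graph is a set of vertices meeting every edge; it is minimal if no proper subset is a vertex cover; the only minimal vertex cover of a graph with no edges is $\emptyset$. The cover ideal $J(G)$ is the squarefree monomial ideal generated by the monomials $\prod_{x\in C}x$ with $C$ a minimal vertex cover of $G$ (so $J(H)=(1)$ if $H$ has no edges). $b_i(I)=\sum_j b_{i,j}(I)$ denotes the $i$-th total Betti number of the ideal $I$ itself (not of $S/I$). *)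

theory Defs
  imports
    "HOL-Library.Poly_Mapping"
    "Jordan_Normal_Form.Matrix_Kernel"
begin

section \<open>Graphs\<close>

record 'v graph =
  verts :: "'v set"
  edges :: "'v set set"

definition simple_graph :: "'v graph \<Rightarrow> bool" where
  "simple_graph G \<longleftrightarrow> finite (verts G) \<and> (\<forall>e\<in>edges G. e \<subseteq> verts G \<and> card e = 2)"

definition nbhd :: "'v graph \<Rightarrow> 'v \<Rightarrow> 'v set" where
  "nbhd G v = {u \<in> verts G. {u, v} \<in> edges G}"

definition closed_nbhd :: "'v graph \<Rightarrow> 'v \<Rightarrow> 'v set" where
  "closed_nbhd G v = insert v (nbhd G v)"

definition remove_verts :: "'v graph \<Rightarrow> 'v set \<Rightarrow> 'v graph" where
  "remove_verts G A = \<lparr>verts = verts G - A, edges = {e \<in> edges G. e \<inter> A = {}}\<rparr>"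

definition is_clique :: "'v graph \<Rightarrow> 'v set \<Rightarrow> bool" where
  "is_clique G A \<longleftrightarrow> A \<subseteq> verts G \<and> (\<forall>u\<in>A. \<forall>v\<in>A. u \<noteq> v \<longrightarrow> {u, v} \<in> edges G)"

text \<open>An induced cycle of length \<open>n\<close> is given by the list of its \<open>n\<close> vertices in cyclic order:
  two listed vertices are adjacent in the graph exactly if they are cyclically consecutive.\<close>

definition induced_cycle :: "'v graph \<Rightarrow> 'v list \<Rightarrow> bool" where
  "induced_cycle G c \<longleftrightarrow>
     3 \<le> length c \<and> distinct c \<and> set c \<subseteq> verts G \<and>
     (\<forall>i<length c. \<forall>j<length c.
        {c ! i, c ! j} \<in> edges G \<longleftrightarrow> j = Suc i mod length c \<or> i = Suc j mod length c)"

definition chordal :: "'v graph \<Rightarrow> bool" where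
  "chordal G \<longleftrightarrow> \<not> (\<exists>c. induced_cycle G c \<and> length c > 3)"

definition vertex_cover :: "'v graph \<Rightarrow> 'v set \<Rightarrow> bool" where
  "vertex_cover G C \<longleftrightarrow> C \<subseteq> verts G \<and> (\<forall>e\<in>edges G. e \<inter> C \<noteq> {})"

definition minimal_vertex_cover :: "'v graph \<Rightarrow> 'v set \<Rightarrow> bool" where
  "minimal_vertex_cover G C \<longleftrightarrow> vertex_cover G C \<and> (\<forall>C'. C' \<subset> C \<longrightarrow> \<not> vertex_cover G C')"

section \<open>The polynomial ring and cover ideals\<close>

text \<open>\<open>('v, 'k) mpoly\<close> is the polynomial ring over the field \<open>'k\<close> whose variables are the elements
  of the finite type \<open>'v\<close>: a polynomial maps exponent vectors to coefficients.\<close>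

type_synonym ('v, 'k) mpoly = "('v \<Rightarrow>\<^sub>0 nat) \<Rightarrow>\<^sub>0 'k"

definition Var :: "'v \<Rightarrow> ('v, 'k::field) mpoly" where
  "Var v = Poly_Mapping.single (Poly_Mapping.single v 1) 1"

definition ideal_gen :: "('v, 'k::field) mpoly set \<Rightarrow> ('v, 'k) mpoly set" where
  "ideal_gen B = Modules.module.span (*) B"

definition cover_ideal :: "'v graph \<Rightarrow> ('v, 'k::field) mpoly set" where
  "cover_ideal G = ideal_gen {\<Prod>v\<in>C. Var v | C. minimal_vertex_cover G C}"

definition mon_degree :: "('v::finite \<Rightarrow>\<^sub>0 nat) \<Rightarrow> nat" where
  "mon_degree m = (\<Sum>v\<in>UNIV. Poly_Mapping.lookup m v)"

section \<open>Minimal graded free resolutions and Betti numbers\<close>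

text \<open>A graded free resolution
  \<open>\<dots> \<rightarrow> F\<^sub>1 \<rightarrow> F\<^sub>0 \<rightarrow> I \<rightarrow> 0\<close>
  of an ideal \<open>I\<close> of the polynomial ring \<open>S\<close>. The list \<open>\<delta> i\<close> holds the degrees of the elements of a
  homogeneous basis of \<open>F\<^sub>i\<close>, that is, \<open>F\<^sub>i = \<Oplus>\<^sub>k S(-(\<delta> i ! k))\<close>. The row \<open>D 0\<close> is the augmentation
  \<open>F\<^sub>0 \<rightarrow> I\<close>, and \<open>D (Suc i)\<close> is the matrix of the differential from \<open>F\<close> in position \<open>Suc i\<close> to
  \<open>F\<^sub>i\<close>. The homogeneity conditions say that all maps preserve degrees; the zero polynomial meets
  them vacuously.\<close>

definition graded_free_resolution ::
  "('v::finite, 'k::field) mpoly set \<Rightarrow> (nat \<Rightarrow> nat list) \<Rightarrow> (nat \<Rightarrow> ('v, 'k) mpoly mat) \<Rightarrow> bool"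
where
  "graded_free_resolution I \<delta> D \<longleftrightarrow>
     D 0 \<in> carrier_mat 1 (length (\<delta> 0)) \<and>
     (\<forall>i. D (Suc i) \<in> carrier_mat (length (\<delta> i)) (length (\<delta> (Suc i)))) \<and>
     (\<forall>b<length (\<delta> 0). \<forall>m\<in>Poly_Mapping.keys (D 0 $$ (0, b)). mon_degree m = \<delta> 0 ! b) \<and>
     (\<forall>i. \<forall>a<length (\<delta> i). \<forall>b<length (\<delta> (Suc i)).
        \<forall>m\<in>Poly_Mapping.keys (D (Suc i) $$ (a, b)). mon_degree m + \<delta> i ! a = \<delta> (Suc i) ! b) \<and>
     I = (\<lambda>v. (D 0 *\<^sub>v v) $ 0) ` carrier_vec (length (\<delta> 0)) \<and>
     (\<forall>i. mat_kernel (D i) = (\<lambda>v. D (Suc i) *\<^sub>v v) ` carrier_vec (length (\<delta> (Suc i))))"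

text \<open>Minimality: the image of every differential \<open>F\<^sub>i\<^sub>+\<^sub>1 \<rightarrow> F\<^sub>i\<close> lies in \<open>\<mm> F\<^sub>i\<close>, where \<open>\<mm>\<close> is the ideal
  generated by all variables. The augmentation \<open>D 0\<close> is not subject to this condition.\<close>

definition minimal_graded_free_resolution ::
  "('v::finite, 'k::field) mpoly set \<Rightarrow> (nat \<Rightarrow> nat list) \<Rightarrow> (nat \<Rightarrow> ('v, 'k) mpoly mat) \<Rightarrow> bool"
where
  "minimal_graded_free_resolution I \<delta> D \<longleftrightarrow>
     graded_free_resolution I \<delta> D \<and>
     (\<forall>i. \<forall>a<length (\<delta> i). \<forall>b<length (\<delta> (Suc i)). D (Suc i) $$ (a, b) \<in> ideal_gen (range Var))"

text \<open>Homogeneous ideals have a minimal graded free resolution, unique up to isomorphism, so the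
  description below determines the number of copies of \<open>S(-j)\<close> in \<open>F\<^sub>i\<close>.\<close>

definition graded_betti :: "('v::finite, 'k::field) mpoly set \<Rightarrow> nat \<Rightarrow> nat \<Rightarrow> nat" where
  "graded_betti I i j =
     (THE n. \<exists>\<delta> D. minimal_graded_free_resolution I \<delta> D \<and> n = count_list (\<delta> i) j)"

definition betti :: "('v::finite, 'k::field) mpoly set \<Rightarrow> nat \<Rightarrow> nat" where
  "betti I i = (\<Sum>j | graded_betti I i j \<noteq> 0. graded_betti I i j)"

end

theory Submission
  imports Defs
begin

text \<open>Let \<open>m\<^sub>t\<close> be the product of the variables in \<open>N(x\<^sub>t)\<close>. A minimal cover of \<open>G\<close> misses exactly
  one vertex \<open>x\<^sub>t\<close> of the clique \<open>N[x\<^sub>1]\<close>, so \<open>J(G)\<close> is the sum of the ideals \<open>m\<^sub>t J(H\<^sub>t)\<close>. Adding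
  these one at a time, starting with \<open>t = 1\<close>, a partial sum \<open>A\<close> meets the next summand
  \<open>L = m\<^sub>t J(H\<^sub>t)\<close> in \<open>x\<^sub>t L\<close>. Both inclusions of \<open>x\<^sub>t L\<close> vanish on Tor: the one into \<open>L\<close> is
  multiplication by \<open>x\<^sub>t\<close>, and the one into \<open>A\<close> is \<open>x\<^sub>1\<close> times the map \<open>x\<^sub>t L \<rightarrow> m\<^sub>1 J(H\<^sub>1)\<close> that divides
  by \<open>x\<^sub>1\<close>. Hence the mapping cone is a minimal resolution of \<open>A + L\<close>, and it contributes
  \<open>b\<^sub>i(J(H\<^sub>t)) + b\<^bsub>i-1\<^esub>(J(H\<^sub>t))\<close>. That minimal resolutions exist at all follows by induction
  from the same construction, since a chordal graph has a simplicial vertex.\<close>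

section \<open>Homogeneous polynomials and matrices\<close>

text \<open>\<open>betti\<close> rests on \<open>THE\<close> over all minimal resolutions, so a
  value is available only once such a resolution exists and all of them agree in their degree
  counts. Uniqueness is proved for every ideal; existence is proved for cover ideals of chordal
  graphs, because the recursion behind the formula also constructs the resolutions. The Tor argument
  is therefore carried out on matrices: vanishing on Tor becomes the statement that the entries of
  the comparison maps lie in the ideal of the variables.

  Starting with t = 1 is essential. Since N[x_1] is a clique, it is contained in N[x_t], so x_t m_t,
  the product over N[x_t], is divisible by x_1 m_1. Even without its factor x_1 it carries J(H_t)
  into the first summand, and this spare factor puts the comparison map into the ideal of the
  variables. Conversely, each earlier x_q is adjacent to x_t, so a monomial of m_t J(H_t) that lies
  in an earlier summand has a further factor x_t. Hence the intersection is neither larger nor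
  smaller than x_t L.\<close>

lemma sum_single_keys:
  "(p :: 'a \<Rightarrow>\<^sub>0 'b::comm_monoid_add) = (\<Sum>k\<in>Poly_Mapping.keys p. Poly_Mapping.single k (Poly_Mapping.lookup p k))"
  by (rule poly_mapping_eqI)
     (auto simp: lookup_sum lookup_single when_def in_keys_iff sum.If_cases sum.delta)

text \<open>Natural exponents add up to zero only if both vanish. The constant coefficient is thus a
  ring map, reduction modulo the variables, and minimality is exploited through it.\<close>

lemma lookup_const_mult:
  fixes p q :: "('v, 'k::field) mpoly"
  shows "Poly_Mapping.lookup (p * q) 0 = Poly_Mapping.lookup p 0 * Poly_Mapping.lookup q 0"
proof -
  have zero: "k + l = 0 \<longleftrightarrow> k = 0 \<and> l = 0" for k l :: "'v \<Rightarrow>\<^sub>0 nat"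
    by (auto simp: poly_mapping_eq_iff fun_eq_iff lookup_add)
  have single: "Poly_Mapping.lookup (Poly_Mapping.single k a * q) 0
      = Poly_Mapping.lookup (Poly_Mapping.single k a) 0 * Poly_Mapping.lookup q 0" for k a
  proof -
    have "Poly_Mapping.lookup (Poly_Mapping.single k a * q) 0
      = (\<Sum>l\<in>Poly_Mapping.keys q. Poly_Mapping.lookup (Poly_Mapping.single (k + l) (a * Poly_Mapping.lookup q l)) 0)"
      by (subst (1) sum_single_keys[of q]) (simp add: sum_distrib_left mult_single lookup_sum)
    also have "\<dots> = (\<Sum>l\<in>Poly_Mapping.keys q. if l = 0 then (if k = 0 then a * Poly_Mapping.lookup q l else 0) else 0)"
      by (rule sum.cong) (auto simp: lookup_single when_def zero)
    also have "\<dots> = Poly_Mapping.lookup (Poly_Mapping.single k a) 0 * Poly_Mapping.lookup q 0"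
      by (auto simp: sum.delta lookup_single when_def in_keys_iff)
    finally show ?thesis .
  qed
  show ?thesis
    by (subst (1 2) sum_single_keys[of p])
       (simp add: sum_distrib_right lookup_sum single)
qed

text \<open>Multiplication by a monomial merely translates coefficients. Its injectivity,
  \<open>monomial_mult_cancel\<close>, is the torsion-freeness that the exactness proofs draw
  on.\<close>

lemma lookup_monomial_mult:
  fixes p :: "('v, 'k::field) mpoly"
  shows "Poly_Mapping.lookup (Poly_Mapping.single t 1 * p) (t + s) = Poly_Mapping.lookup p s"
proof -
  have "Poly_Mapping.lookup (Poly_Mapping.single t 1 * p) (t + s)
      = (\<Sum>k\<in>Poly_Mapping.keys p. Poly_Mapping.lookup (Poly_Mapping.single (t + k) (Poly_Mapping.lookup p k)) (t + s))"
    by (subst (1) sum_single_keys[of p]) (simp add: sum_distrib_left mult_single lookup_sum)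
  also have "\<dots> = (\<Sum>k\<in>Poly_Mapping.keys p. if k = s then Poly_Mapping.lookup p k else 0)"
    by (rule sum.cong) (auto simp: lookup_single when_def)
  also have "\<dots> = Poly_Mapping.lookup p s"
    by (auto simp: sum.delta in_keys_iff)
  finally show ?thesis .
qed

lemma monomial_mult_cancel:
  fixes p q :: "('v, 'k::field) mpoly"
  assumes "Poly_Mapping.single t 1 * p = Poly_Mapping.single t 1 * q"
  shows "p = q"
  by (rule poly_mapping_eqI) (metis assms lookup_monomial_mult)

text \<open>The part of degree \<open>e\<close> of \<open>p\<close> as an element of \<open>S(-c)\<close>; in this form no truncated \<open>e - c\<close> occurs.\<close>

definition hpart :: "nat \<Rightarrow> nat \<Rightarrow> ('v::finite, 'k::field) mpoly \<Rightarrow> ('v, 'k) mpoly" where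
  "hpart c e p = (\<Sum>m\<in>Poly_Mapping.keys p.
     if mon_degree m + c = e then Poly_Mapping.single m (Poly_Mapping.lookup p m) else 0)"

lemma lookup_hpart:
  "Poly_Mapping.lookup (hpart c e p) m = (if mon_degree m + c = e then Poly_Mapping.lookup p m else 0)"
proof -
  have "Poly_Mapping.lookup (hpart c e p) m = (\<Sum>k\<in>Poly_Mapping.keys p. if k = m then
      (if mon_degree m + c = e then Poly_Mapping.lookup p m else 0) else 0)"
    unfolding hpart_def lookup_sum by (rule sum.cong) (auto simp: lookup_single when_def)
  then show ?thesis by (auto simp: sum.delta in_keys_iff)
qed

lemma hpart_add: "hpart c e (p + q) = hpart c e p + hpart c e q"
  by (rule poly_mapping_eqI) (simp add: lookup_hpart lookup_add)

lemma hpart_0 [simp]: "hpart c e 0 = 0"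
  by (simp add: hpart_def)

lemma hpart_sum: "hpart c e (sum f A) = (\<Sum>a\<in>A. hpart c e (f a))"
  by (induction A rule: infinite_finite_induct) (auto simp: hpart_add)

lemma hpart_id:
  assumes "\<And>m. m \<in> Poly_Mapping.keys p \<Longrightarrow> mon_degree m + c = e"
  shows "hpart c e p = p"
  by (rule poly_mapping_eqI) (use assms in \<open>auto simp: lookup_hpart in_keys_iff\<close>)

lemma keys_hpart: "m \<in> Poly_Mapping.keys (hpart c e p) \<Longrightarrow> mon_degree m + c = e"
  by (auto simp: in_keys_iff lookup_hpart split: if_splits)

lemma mon_degree_add: "mon_degree (m + n) = mon_degree m + mon_degree n"
  by (simp add: mon_degree_def lookup_add sum.distrib)

lemma hpart_single:
  "hpart c e (Poly_Mapping.single m a) = (if mon_degree m + c = e then Poly_Mapping.single m a else 0)"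
  by (rule poly_mapping_eqI) (auto simp: lookup_hpart lookup_single when_def)

text \<open>The hypothesis says that \<open>q\<close> is a degree-preserving map from S(-c) to
  S(-r), so it commutes with degree-\<open>e\<close> parts. Both sides are bilinear, which leaves
  the case of two monomials.\<close>

lemma hpart_mult:
  assumes q: "\<And>m. m \<in> Poly_Mapping.keys q \<Longrightarrow> mon_degree m + r = c"
  shows "q * hpart c e p = hpart r e (q * p)"
proof -
  have *: "Poly_Mapping.single m a * hpart c e (Poly_Mapping.single n b)
      = hpart r e (Poly_Mapping.single m a * Poly_Mapping.single n b)"
    if "m \<in> Poly_Mapping.keys q" for m n a b
    using q[OF that] by (auto simp: hpart_single mult_single mon_degree_add)
  have hp: "hpart c e p = (\<Sum>n\<in>Poly_Mapping.keys p. hpart c e (Poly_Mapping.single n (Poly_Mapping.lookup p n)))"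
    using arg_cong[OF sum_single_keys[of p], of "hpart c e"] by (simp only: hpart_sum)
  have qp: "q * p = (\<Sum>m\<in>Poly_Mapping.keys q. \<Sum>n\<in>Poly_Mapping.keys p.
     Poly_Mapping.single m (Poly_Mapping.lookup q m) * Poly_Mapping.single n (Poly_Mapping.lookup p n))"
    using arg_cong2[OF sum_single_keys[of q] sum_single_keys[of p], of "(*)"] by (simp only: sum_product)
  have "q * hpart c e p = (\<Sum>m\<in>Poly_Mapping.keys q. \<Sum>n\<in>Poly_Mapping.keys p.
     Poly_Mapping.single m (Poly_Mapping.lookup q m) * hpart c e (Poly_Mapping.single n (Poly_Mapping.lookup p n)))"
    unfolding hp by (subst sum_single_keys[of q]) (simp add: sum_product)
  also have "\<dots> = (\<Sum>m\<in>Poly_Mapping.keys q. \<Sum>n\<in>Poly_Mapping.keys p.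
     hpart r e (Poly_Mapping.single m (Poly_Mapping.lookup q m) * Poly_Mapping.single n (Poly_Mapping.lookup p n)))"
    by (intro sum.cong refl *)
  also have "\<dots> = hpart r e (q * p)"
    by (simp add: qp hpart_sum)
  finally show ?thesis .
qed

text \<open>Rows belong to the generators of the target, columns to those of the source. Adding the
  row degree on the left keeps truncated subtraction out of the condition.\<close>

definition hom_mat :: "nat list \<Rightarrow> nat list \<Rightarrow> ('v::finite, 'k::field) mpoly mat \<Rightarrow> bool" where
  "hom_mat \<rho> \<gamma> M \<longleftrightarrow> M \<in> carrier_mat (length \<rho>) (length \<gamma>) \<and>
     (\<forall>a<length \<rho>. \<forall>b<length \<gamma>. \<forall>m\<in>Poly_Mapping.keys (M $$ (a, b)). mon_degree m + \<rho> ! a = \<gamma> ! b)"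

lemma hom_mat_carrier: "hom_mat \<rho> \<gamma> M \<Longrightarrow> M \<in> carrier_mat (length \<rho>) (length \<gamma>)"
  by (simp add: hom_mat_def)

lemma hom_mat_shift:
  "hom_mat \<rho> \<gamma> M \<Longrightarrow> hom_mat (map ((+) d) \<rho>) (map ((+) d) \<gamma>) M"
  by (fastforce simp: hom_mat_def)

lemma hom_mat_smult:
  assumes "hom_mat \<rho> \<gamma> M" "\<And>m. m \<in> Poly_Mapping.keys w \<Longrightarrow> mon_degree m = d"
  shows "hom_mat \<rho> (map ((+) d) \<gamma>) (w \<cdot>\<^sub>m M)"
proof -
  have "mon_degree m + \<rho> ! a = d + \<gamma> ! b"
    if ab: "a < length \<rho>" "b < length \<gamma>" and m: "m \<in> Poly_Mapping.keys (w * M $$ (a, b))" for a b m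
  proof -
    obtain k l where "m = k + l" "k \<in> Poly_Mapping.keys w" "l \<in> Poly_Mapping.keys (M $$ (a, b))"
      using m keys_mult[of w "M $$ (a, b)"] by blast
    then show ?thesis
      using assms ab unfolding hom_mat_def by (fastforce simp: mon_degree_add)
  qed
  then show ?thesis
    using assms(1) by (auto simp: hom_mat_def)
qed

lemma hom_mat_uminus: "hom_mat \<rho> \<gamma> M \<Longrightarrow> hom_mat \<rho> \<gamma> (- M)"
  by (auto simp: hom_mat_def in_keys_iff)

lemma hom_mat_zero: "hom_mat \<rho> \<gamma> (0\<^sub>m (length \<rho>) (length \<gamma>))"
  by (auto simp: hom_mat_def)

lemma hom_mat_one: "hom_mat \<rho> \<rho> (1\<^sub>m (length \<rho>))"
  by (auto simp: hom_mat_def mon_degree_def)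

lemma hom_mat_mult:
  assumes "hom_mat \<rho> \<gamma> M" "hom_mat \<gamma> \<epsilon> N"
  shows "hom_mat \<rho> \<epsilon> (M * N)"
proof -
  have "mon_degree m + \<rho> ! a = \<epsilon> ! b"
    if ab: "a < length \<rho>" "b < length \<epsilon>"
      and m: "m \<in> Poly_Mapping.keys (\<Sum>c\<in>{0..<length \<gamma>}. M $$ (a, c) * N $$ (c, b))" for a b m
  proof -
    obtain c where c: "c < length \<gamma>" "m \<in> Poly_Mapping.keys (M $$ (a, c) * N $$ (c, b))"
    proof -
      have "(\<Sum>c\<in>{0..<length \<gamma>}. Poly_Mapping.lookup (M $$ (a, c) * N $$ (c, b)) m) \<noteq> 0"
        using m by (simp add: in_keys_iff lookup_sum)
      then obtain c where "c \<in> {0..<length \<gamma>}" "Poly_Mapping.lookup (M $$ (a, c) * N $$ (c, b)) m \<noteq> 0"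
        by (rule sum.not_neutral_contains_not_neutral)
      then show thesis by (intro that[of c]) (simp_all add: in_keys_iff)
    qed
    obtain k l where "m = k + l" "k \<in> Poly_Mapping.keys (M $$ (a, c))" "l \<in> Poly_Mapping.keys (N $$ (c, b))"
      using c(2) keys_mult[of "M $$ (a, c)" "N $$ (c, b)"] by blast
    then have "mon_degree k + \<rho> ! a = \<gamma> ! c" "mon_degree l + \<gamma> ! c = \<epsilon> ! b" "m = k + l"
      using assms ab c(1) unfolding hom_mat_def by blast+
    then show ?thesis by (simp add: mon_degree_add)
  qed
  moreover have "(M * N) $$ (a, b) = (\<Sum>c\<in>{0..<length \<gamma>}. M $$ (a, c) * N $$ (c, b))"
    if "a < length \<rho>" "b < length \<epsilon>" for a b
    using that assms by (auto simp: hom_mat_def scalar_prod_def)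
  moreover have "M * N \<in> carrier_mat (length \<rho>) (length \<epsilon>)"
    using assms[THEN hom_mat_carrier] by (rule mult_carrier_mat)
  ultimately show ?thesis
    by (simp add: hom_mat_def)
qed

lemma hom_mat_four_block:
  assumes "hom_mat \<rho> \<gamma> A" "hom_mat \<rho> \<gamma>' B" "hom_mat \<rho>' \<gamma> C" "hom_mat \<rho>' \<gamma>' D"
  shows "hom_mat (\<rho> @ \<rho>') (\<gamma> @ \<gamma>') (four_block_mat A B C D)"
  using assms by (auto simp: hom_mat_def nth_append)

text \<open>Projectivity of graded free modules. From arbitrary preimages of the columns only the
  components of the correct degree are kept; \<open>D\<close> commutes with \<open>hpart\<close> and
  the columns of \<open>M\<close> are already homogeneous, so the truncated preimages still
  work.\<close>

lemma hom_mat_lift: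
  fixes D :: "('v::finite, 'k::field) mpoly mat"
  assumes D: "hom_mat \<rho> \<gamma> D" and M: "hom_mat \<rho> \<epsilon> M"
    and im: "\<And>b. b < length \<epsilon> \<Longrightarrow> col M b \<in> (\<lambda>v. D *\<^sub>v v) ` carrier_vec (length \<gamma>)"
  obtains N where "hom_mat \<gamma> \<epsilon> N" "D * N = M"
proof -
  have "\<exists>v. v \<in> carrier_vec (length \<gamma>) \<and> (b < length \<epsilon> \<longrightarrow> col M b = D *\<^sub>v v)" for b
    using im[of b] by (cases "b < length \<epsilon>") (auto intro: zero_carrier_vec)
  then obtain v where v: "\<And>b. v b \<in> carrier_vec (length \<gamma>)"
      "\<And>b. b < length \<epsilon> \<Longrightarrow> col M b = D *\<^sub>v v b"
    by metis
  define N where "N = mat (length \<gamma>) (length \<epsilon>) (\<lambda>(c, b). hpart (\<gamma> ! c) (\<epsilon> ! b) (v b $ c))"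
  have cD: "D \<in> carrier_mat (length \<rho>) (length \<gamma>)" and cM: "M \<in> carrier_mat (length \<rho>) (length \<epsilon>)"
    using D M by (auto simp: hom_mat_def)
  show ?thesis
  proof
    show "hom_mat \<gamma> \<epsilon> N"
      by (auto simp: hom_mat_def N_def dest: keys_hpart)
    show "D * N = M"
    proof (rule eq_matI)
      fix a b assume "a < dim_row M" "b < dim_col M"
      then have ab: "a < length \<rho>" "b < length \<epsilon>" using cM by auto
      have "(D * N) $$ (a, b) = (\<Sum>c\<in>{0..<length \<gamma>}. D $$ (a, c) * hpart (\<gamma> ! c) (\<epsilon> ! b) (v b $ c))"
        using ab cD by (auto simp: N_def scalar_prod_def)
      also have "\<dots> = (\<Sum>c\<in>{0..<length \<gamma>}. hpart (\<rho> ! a) (\<epsilon> ! b) (D $$ (a, c) * v b $ c))"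
        by (intro sum.cong refl hpart_mult) (use D ab in \<open>auto simp: hom_mat_def\<close>)
      also have "\<dots> = hpart (\<rho> ! a) (\<epsilon> ! b) ((D *\<^sub>v v b) $ a)"
        using ab cD v(1)[of b] by (auto simp: hpart_sum scalar_prod_def)
      also have "(D *\<^sub>v v b) $ a = M $$ (a, b)"
        using v(2)[OF ab(2), symmetric] ab cM by simp
      also have "hpart (\<rho> ! a) (\<epsilon> ! b) (M $$ (a, b)) = M $$ (a, b)"
        by (rule hpart_id) (use M ab in \<open>auto simp: hom_mat_def\<close>)
      finally show "(D * N) $$ (a, b) = M $$ (a, b)" .
    qed (use cD cM in \<open>auto simp: N_def\<close>)
  qed
qed

text \<open>The ungraded version is enough for homotopies, of which only the constant terms of
  products with a minimal differential are read off.\<close>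

lemma mat_lift:
  fixes D :: "'a::comm_ring_1 mat"
  assumes D: "D \<in> carrier_mat n m" and M: "M \<in> carrier_mat n l"
    and im: "\<And>b. b < l \<Longrightarrow> col M b \<in> (\<lambda>v. D *\<^sub>v v) ` carrier_vec m"
  obtains N where "N \<in> carrier_mat m l" "D * N = M"
proof -
  have "\<exists>v. v \<in> carrier_vec m \<and> (b < l \<longrightarrow> col M b = D *\<^sub>v v)" for b
    using im[of b] by (cases "b < l") (auto intro: zero_carrier_vec)
  then obtain v where v: "\<And>b. v b \<in> carrier_vec m" "\<And>b. b < l \<Longrightarrow> col M b = D *\<^sub>v v b"
    by metis
  show ?thesis
  proof
    show N: "mat_of_cols m (map v [0..<l]) \<in> carrier_mat m l" by (simp add: mat_of_cols_carrier(1)[of m "map v [0..<l]", simplified])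
    show "D * mat_of_cols m (map v [0..<l]) = M"
      by (rule mat_col_eqI) (use D M N v in \<open>auto\<close>)
  qed
qed

lemma mult_mat_vec_smult:
  fixes A :: "'a::comm_ring_1 mat"
  assumes "A \<in> carrier_mat n m" "v \<in> carrier_vec m"
  shows "A *\<^sub>v (c \<cdot>\<^sub>v v) = c \<cdot>\<^sub>v (A *\<^sub>v v)"
  using assms by (intro eq_vecI) auto

text \<open>The degrees of the module in which \<open>D i\<close> takes its values; the augmentation has the
  target \<open>S\<close>, generated in degree \<open>0\<close>.\<close>

definition target_degs :: "(nat \<Rightarrow> nat list) \<Rightarrow> nat \<Rightarrow> nat list" where
  "target_degs \<delta> i = (case i of 0 \<Rightarrow> [0] | Suc j \<Rightarrow> \<delta> j)"

lemma target_degs_simps [simp]: "target_degs \<delta> 0 = [0]" "target_degs \<delta> (Suc i) = \<delta> i"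
  by (simp_all add: target_degs_def)

lemma graded_free_resolution_iff:
  "graded_free_resolution I \<delta> D \<longleftrightarrow>
     (\<forall>i. hom_mat (target_degs \<delta> i) (\<delta> i) (D i)) \<and>
     I = (\<lambda>v. (D 0 *\<^sub>v v) $ 0) ` carrier_vec (length (\<delta> 0)) \<and>
     (\<forall>i. mat_kernel (D i) = (\<lambda>v. D (Suc i) *\<^sub>v v) ` carrier_vec (length (\<delta> (Suc i))))"
proof -
  have "(\<forall>i. hom_mat (target_degs \<delta> i) (\<delta> i) (D i)) \<longleftrightarrow>
      hom_mat [0] (\<delta> 0) (D 0) \<and> (\<forall>i. hom_mat (\<delta> i) (\<delta> (Suc i)) (D (Suc i)))"
    by (metis target_degs_simps not0_implies_Suc)
  then show ?thesis
    unfolding graded_free_resolution_def hom_mat_def by auto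
qed

lemma module_mult: "Modules.module ((*) :: 'a::comm_ring_1 \<Rightarrow> 'a \<Rightarrow> 'a)"
  by unfold_locales (simp_all add: algebra_simps)

lemma ideal_gen_mult: "p \<in> ideal_gen B \<Longrightarrow> q * p \<in> ideal_gen B"
  unfolding ideal_gen_def by (rule module.span_scale[OF module_mult])

lemma ideal_gen_zero: "0 \<in> ideal_gen B"
  unfolding ideal_gen_def by (rule module.span_zero[OF module_mult])

lemma ideal_gen_uminus: "p \<in> ideal_gen B \<Longrightarrow> - p \<in> ideal_gen B"
  using ideal_gen_mult[of p B "-1"] by simp

lemma ideal_gen_base: "p \<in> B \<Longrightarrow> p \<in> ideal_gen B"
  unfolding ideal_gen_def by (rule module.span_base[OF module_mult])

lemma ideal_gen_subset:
  assumes "B \<subseteq> I" "0 \<in> I" "\<And>p q. p \<in> I \<Longrightarrow> q \<in> I \<Longrightarrow> p + q \<in> I" "\<And>p q. p \<in> I \<Longrightarrow> q * p \<in> I"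
  shows "ideal_gen B \<subseteq> I"
  unfolding ideal_gen_def
  by (rule module.span_minimal[OF module_mult]) (use assms in \<open>auto intro: module.subspaceI[OF module_mult]\<close>)

lemma maximal_ideal_const:
  assumes "(p :: ('v::finite, 'k::field) mpoly) \<in> ideal_gen (range Var)"
  shows "Poly_Mapping.lookup p 0 = 0"
proof -
  have "Poly_Mapping.single v (1::nat) \<noteq> 0" for v :: 'v
    by (metis lookup_single_eq lookup_zero zero_neq_one)
  then have "ideal_gen (range Var) \<subseteq> {p :: ('v, 'k) mpoly. Poly_Mapping.lookup p 0 = 0}"
    by (intro ideal_gen_subset) (auto simp: Var_def lookup_single when_def lookup_add lookup_const_mult)
  then show ?thesis using assms by auto
qed

section \<open>Uniqueness of minimal resolutions\<close>

lemma resolutionD: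
  assumes "graded_free_resolution I \<delta> D"
  shows "hom_mat (target_degs \<delta> i) (\<delta> i) (D i)"
    and "D i \<in> carrier_mat (length (target_degs \<delta> i)) (length (\<delta> i))"
    and "I = (\<lambda>v. (D 0 *\<^sub>v v) $ 0) ` carrier_vec (length (\<delta> 0))"
    and "mat_kernel (D i) = (\<lambda>v. D (Suc i) *\<^sub>v v) ` carrier_vec (length (\<delta> (Suc i)))"
  using assms by (auto simp: graded_free_resolution_iff dest: hom_mat_carrier)

lemma resolution_kernelE:
  assumes "graded_free_resolution I \<delta> D" "v \<in> carrier_vec (length (\<delta> i))"
    and "D i *\<^sub>v v = 0\<^sub>v (length (target_degs \<delta> i))"
  obtains u where "u \<in> carrier_vec (length (\<delta> (Suc i)))" "v = D (Suc i) *\<^sub>v u"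
proof -
  have "v \<in> mat_kernel (D i)"
    using mat_kernelI[OF resolutionD(2)[OF assms(1)] assms(2,3)] .
  then show ?thesis
    using that unfolding resolutionD(4)[OF assms(1)] by blast
qed

lemma resolution_mem:
  assumes "graded_free_resolution I \<delta> D"
  shows "p \<in> I \<longleftrightarrow> (\<exists>v\<in>carrier_vec (length (\<delta> 0)). D 0 *\<^sub>v v = vec 1 (\<lambda>_. p))"
proof -
  have "(D 0 *\<^sub>v v = vec 1 (\<lambda>_. p)) \<longleftrightarrow> p = (D 0 *\<^sub>v v) $ 0" for v
    using resolutionD(2)[OF assms, of 0] by (auto simp: vec_eq_iff simp del: index_mult_mat_vec)
  then show ?thesis
    using resolutionD(3)[OF assms] by (auto simp del: index_mult_mat_vec)
qed

lemma resolution_complex_vec: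
  assumes "graded_free_resolution I \<delta> D" "u \<in> carrier_vec (length (\<delta> (Suc i)))"
  shows "D i *\<^sub>v (D (Suc i) *\<^sub>v u) = 0\<^sub>v (length (target_degs \<delta> i))"
proof -
  have "D (Suc i) *\<^sub>v u \<in> mat_kernel (D i)"
    unfolding resolutionD(4)[OF assms(1)] using assms(2) by blast
  then show ?thesis
    using mat_kernelD[OF resolutionD(2)[OF assms(1)]] by blast
qed

lemma mult_mat_unit_vec:
  fixes A :: "'a::comm_ring_1 mat"
  assumes "A \<in> carrier_mat n m" "b < m"
  shows "A *\<^sub>v unit_vec m b = col A b"
  using assms by (intro eq_vecI) auto

lemma minus_zero_mat:
  fixes A :: "'a::comm_ring_1 mat"
  assumes "A \<in> carrier_mat n m"
  shows "A - 0\<^sub>m n m = A"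
  using assms by (intro eq_matI) auto

lemma mat_eq_zeroI:
  assumes "M \<in> carrier_mat n m" "\<And>b. b < m \<Longrightarrow> col M b = 0\<^sub>v n"
  shows "M = 0\<^sub>m n m"
  by (rule mat_col_eqI) (use assms in auto)

lemma resolution_complex:
  assumes "graded_free_resolution I \<delta> D"
  shows "D i * D (Suc i) = 0\<^sub>m (length (target_degs \<delta> i)) (length (\<delta> (Suc i)))"
proof (rule mat_eq_zeroI)
  note c = resolutionD(2)[OF assms, of i] resolutionD(2)[OF assms, of "Suc i", simplified]
  show "D i * D (Suc i) \<in> carrier_mat (length (target_degs \<delta> i)) (length (\<delta> (Suc i)))"
    using c by (rule mult_carrier_mat)
  fix b assume b: "b < length (\<delta> (Suc i))"
  have "col (D i * D (Suc i)) b = D i *\<^sub>v (D (Suc i) *\<^sub>v unit_vec (length (\<delta> (Suc i))) b)"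
    using col_mult2[OF c b] mult_mat_unit_vec[OF c(2) b] by simp
  then show "col (D i * D (Suc i)) b = 0\<^sub>v (length (target_degs \<delta> i))"
    using resolution_complex_vec[OF assms] by simp
qed

lemma resolution_lift_col:
  assumes R: "graded_free_resolution I \<delta> D" and M: "M \<in> carrier_mat (length (\<delta> i)) m"
    and z: "D i * M = 0\<^sub>m (length (target_degs \<delta> i)) m" and b: "b < m"
  shows "col M b \<in> (\<lambda>v. D (Suc i) *\<^sub>v v) ` carrier_vec (length (\<delta> (Suc i)))"
proof -
  have "D i *\<^sub>v col M b = col (D i * M) b"
    using col_mult2[OF resolutionD(2)[OF R] M b] by simp
  then have "D i *\<^sub>v col M b = 0\<^sub>v (length (target_degs \<delta> i))"
    using z b by simp
  moreover have "col M b \<in> carrier_vec (length (\<delta> i))" using M b by simp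
  ultimately show ?thesis
    using resolution_kernelE[OF R] by blast
qed

text \<open>The comparison theorem for multiplication by \<open>w\<close> from \<open>I\<close> to
  \<open>J\<close>. As \<open>w\<close> has degree \<open>d\<close>, the generators of the source
  are shifted by \<open>d\<close> to make the lift degree-preserving.\<close>

lemma chain_map_lift:
  fixes B A :: "nat \<Rightarrow> ('v::finite, 'k::field) mpoly mat"
  assumes RB: "graded_free_resolution I \<beta> B" and RA: "graded_free_resolution J \<alpha> A"
    and w: "\<And>m. m \<in> Poly_Mapping.keys w \<Longrightarrow> mon_degree m = d"
    and sub: "\<And>p. p \<in> I \<Longrightarrow> w * p \<in> J"
  obtains g where "\<And>i. hom_mat (\<alpha> i) (map ((+) d) (\<beta> i)) (g i)"
    "A 0 * g 0 = w \<cdot>\<^sub>m B 0" "\<And>i. A (Suc i) * g (Suc i) = g i * B (Suc i)"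
proof -
  note cA = resolutionD(2)[OF RA] and cB = resolutionD(2)[OF RB]
  have cA0: "A 0 \<in> carrier_mat 1 (length (\<alpha> 0))" and cB0: "B 0 \<in> carrier_mat 1 (length (\<beta> 0))"
    using cA[of 0] cB[of 0] by auto
  have cAS: "A (Suc i) \<in> carrier_mat (length (\<alpha> i)) (length (\<alpha> (Suc i)))"
    and cBS: "B (Suc i) \<in> carrier_mat (length (\<beta> i)) (length (\<beta> (Suc i)))" for i
    using cA[of "Suc i"] cB[of "Suc i"] by auto
  \<comment> \<open>The second conjunct lets the construction continue: \<open>g * B (Suc i)\<close>
    maps into the kernel of \<open>A i\<close>, hence lifts through
    \<open>A (Suc i)\<close>.\<close>
  let ?P = "\<lambda>i g. hom_mat (\<alpha> i) (map ((+) d) (\<beta> i)) g \<and>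
    A i * g * B (Suc i) = 0\<^sub>m (length (target_degs \<alpha> i)) (length (\<beta> (Suc i))) \<and>
    (i = 0 \<longrightarrow> A 0 * g = w \<cdot>\<^sub>m B 0)"
  have start: "\<exists>g. ?P 0 g"
  proof -
    have col: "col (w \<cdot>\<^sub>m B 0) b \<in> (\<lambda>v. A 0 *\<^sub>v v) ` carrier_vec (length (\<alpha> 0))"
      if b: "b < length (map ((+) d) (\<beta> 0))" for b
    proof -
      have "B 0 *\<^sub>v unit_vec (length (\<beta> 0)) b = col (B 0) b"
        using mult_mat_unit_vec[OF cB0] b by simp
      also have "\<dots> = vec 1 (\<lambda>_. B 0 $$ (0, b))"
        using cB0 b by (intro eq_vecI) auto
      finally have "B 0 $$ (0, b) \<in> I"
        unfolding resolution_mem[OF RB] by (intro bexI[of _ "unit_vec (length (\<beta> 0)) b"]) auto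
      then have "w * B 0 $$ (0, b) \<in> J" by (rule sub)
      then obtain v where v: "v \<in> carrier_vec (length (\<alpha> 0))"
          "A 0 *\<^sub>v v = vec 1 (\<lambda>_. w * B 0 $$ (0, b))"
        unfolding resolution_mem[OF RA] by blast
      have "col (w \<cdot>\<^sub>m B 0) b = vec 1 (\<lambda>_. w * B 0 $$ (0, b))"
        using cB0 b by (intro eq_vecI) auto
      then show ?thesis using v by (metis imageI)
    qed
    obtain g where g: "hom_mat (\<alpha> 0) (map ((+) d) (\<beta> 0)) g" "A 0 * g = w \<cdot>\<^sub>m B 0"
      by (rule hom_mat_lift[OF resolutionD(1)[OF RA, of 0, simplified]
            hom_mat_smult[OF resolutionD(1)[OF RB, of 0, simplified] w] col])
    have "A 0 * g * B (Suc 0) = w \<cdot>\<^sub>m (B 0 * B (Suc 0))"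
      unfolding g(2) using cB0 cBS[of 0] by (rule mult_smult_assoc_mat)
    also have "\<dots> = 0\<^sub>m 1 (length (\<beta> (Suc 0)))"
      using resolution_complex[OF RB, of 0] by simp
    finally show ?thesis using g by (auto simp: numeral_eq_Suc)
  qed
  have step: "\<exists>g'. ?P (Suc i) g' \<and> A (Suc i) * g' = g * B (Suc i)" if P: "?P i g" for i g
  proof -
    have cg: "g \<in> carrier_mat (length (\<alpha> i)) (length (\<beta> i))"
      using P hom_mat_carrier[of "\<alpha> i" "map ((+) d) (\<beta> i)" g] by simp
    have cM: "g * B (Suc i) \<in> carrier_mat (length (\<alpha> i)) (length (\<beta> (Suc i)))"
      using cg cBS by (rule mult_carrier_mat)
    have z: "A i * (g * B (Suc i)) = 0\<^sub>m (length (target_degs \<alpha> i)) (length (\<beta> (Suc i)))"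
      using P assoc_mult_mat[OF cA[of i] cg cBS] by simp
    have h: "hom_mat (\<alpha> i) (map ((+) d) (\<beta> (Suc i))) (g * B (Suc i))"
      using hom_mat_mult[OF conjunct1[OF P] hom_mat_shift[OF resolutionD(1)[OF RB, of "Suc i", simplified]]] .
    obtain g' where g': "hom_mat (\<alpha> (Suc i)) (map ((+) d) (\<beta> (Suc i))) g'" "A (Suc i) * g' = g * B (Suc i)"
      by (rule hom_mat_lift[OF resolutionD(1)[OF RA, of "Suc i", simplified] h
            resolution_lift_col[OF RA cM z]]) simp_all
    have "A (Suc i) * g' * B (Suc (Suc i)) = g * (B (Suc i) * B (Suc (Suc i)))"
      unfolding g'(2) using assoc_mult_mat[OF cg cBS[of i] cBS[of "Suc i"]] .
    also have "\<dots> = 0\<^sub>m (length (\<alpha> i)) (length (\<beta> (Suc (Suc i))))"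
      using resolution_complex[OF RB, of "Suc i"] cg by simp
    finally show ?thesis using g' by auto
  qed
  obtain g where "\<And>i. ?P i (g i)" "\<And>i. A (Suc i) * g (Suc i) = g i * B (Suc i)"
    using dependent_nat_choice[of ?P "\<lambda>i g g'. A (Suc i) * g' = g * B (Suc i)"] start step by blast
  then show ?thesis using that by blast
qed

text \<open>A chain endomorphism lifting \<open>0\<close> is null-homotopic, hence vanishes modulo the variables if
  the resolution is minimal.\<close>

lemma null_homotopic_const:
  fixes A :: "nat \<Rightarrow> ('v::finite, 'k::field) mpoly mat"
  assumes RA: "minimal_graded_free_resolution I \<alpha> A"
    and c\<phi>: "\<And>i. \<phi> i \<in> carrier_mat (length (\<alpha> i)) (length (\<alpha> i))"
    and \<phi>0: "A 0 * \<phi> 0 = 0\<^sub>m 1 (length (\<alpha> 0))"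
    and \<phi>S: "\<And>i. A (Suc i) * \<phi> (Suc i) = \<phi> i * A (Suc i)"
    and ab: "a < length (\<alpha> i)" "b < length (\<alpha> i)"
  shows "Poly_Mapping.lookup (\<phi> i $$ (a, b)) 0 = 0"
proof -
  have R: "graded_free_resolution I \<alpha> A"
    and min: "\<And>i a b. a < length (\<alpha> i) \<Longrightarrow> b < length (\<alpha> (Suc i)) \<Longrightarrow>
      Poly_Mapping.lookup (A (Suc i) $$ (a, b)) 0 = 0"
    using RA maximal_ideal_const by (auto simp: minimal_graded_free_resolution_def)
  note cA = resolutionD(2)[OF R]
  have cAS: "A (Suc i) \<in> carrier_mat (length (\<alpha> i)) (length (\<alpha> (Suc i)))" for i
    using cA[of "Suc i"] by simp
  have minL: "Poly_Mapping.lookup ((A (Suc i) * X) $$ (a, b)) 0 = 0"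
    if "X \<in> carrier_mat (length (\<alpha> (Suc i))) m" "a < length (\<alpha> i)" "b < m" for X m a b i
    using that cAS[of i] min by (auto simp: scalar_prod_def lookup_sum lookup_const_mult)
  have minR: "Poly_Mapping.lookup ((X * A (Suc i)) $$ (a, b)) 0 = 0"
    if "X \<in> carrier_mat m (length (\<alpha> i))" "a < m" "b < length (\<alpha> (Suc i))" for X m a b i
    using that cAS[of i] min by (auto simp: scalar_prod_def lookup_sum lookup_const_mult)
  \<comment> \<open>The homotopy equation at \<open>i\<close> involves the preceding homotopy, but
    that term disappears after multiplication by \<open>A (Suc i)\<close> on the right. So a single
    \<open>h\<close> can be carried through the induction.\<close>
  let ?P = "\<lambda>i h. h \<in> carrier_mat (length (\<alpha> (Suc i))) (length (\<alpha> i)) \<and>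
     A (Suc i) * h * A (Suc i) = \<phi> i * A (Suc i) \<and>
     (\<forall>a<length (\<alpha> i). \<forall>b<length (\<alpha> i). Poly_Mapping.lookup (\<phi> i $$ (a, b)) 0 = 0)"
  have "\<exists>h. ?P i h"
  proof (induction i)
    case 0
    obtain h where h: "h \<in> carrier_mat (length (\<alpha> (Suc 0))) (length (\<alpha> 0))" "A (Suc 0) * h = \<phi> 0"
      by (rule mat_lift[OF cAS[of 0] c\<phi>[of 0] resolution_lift_col[OF R c\<phi>[of 0]]]) (use \<phi>0 in simp_all)
    then show ?case using minL[OF h(1)] by auto
  next
    case (Suc i)
    then obtain h where h: "h \<in> carrier_mat (length (\<alpha> (Suc i))) (length (\<alpha> i))"
        "A (Suc i) * h * A (Suc i) = \<phi> i * A (Suc i)" by blast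
    \<comment> \<open>The columns are cycles, since \<open>A (Suc i) * \<phi> (Suc i)\<close>,
      \<open>\<phi> i * A (Suc i)\<close> and \<open>A (Suc i) * h * A (Suc i)\<close> coincide; the
      lift of this matrix is the next homotopy.\<close>
    let ?M = "\<phi> (Suc i) - h * A (Suc i)"
    have chA: "h * A (Suc i) \<in> carrier_mat (length (\<alpha> (Suc i))) (length (\<alpha> (Suc i)))"
      using h(1) cAS by (rule mult_carrier_mat)
    have cM: "?M \<in> carrier_mat (length (\<alpha> (Suc i))) (length (\<alpha> (Suc i)))"
      using minus_carrier_mat[OF chA] .
    have "A (Suc i) * ?M = A (Suc i) * \<phi> (Suc i) - A (Suc i) * (h * A (Suc i))"
      by (rule mult_minus_distrib_mat[OF cAS c\<phi> chA])
    also have "A (Suc i) * (h * A (Suc i)) = A (Suc i) * \<phi> (Suc i)"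
      using h(2) assoc_mult_mat[OF cAS h(1) cAS] \<phi>S by simp
    also have "A (Suc i) * \<phi> (Suc i) - A (Suc i) * \<phi> (Suc i) = 0\<^sub>m (length (\<alpha> i)) (length (\<alpha> (Suc i)))"
      by (rule minus_r_inv_mat[OF mult_carrier_mat[OF cAS c\<phi>]])
    finally have z: "A (Suc i) * ?M = 0\<^sub>m (length (target_degs \<alpha> (Suc i))) (length (\<alpha> (Suc i)))" by simp
    obtain h' where h': "h' \<in> carrier_mat (length (\<alpha> (Suc (Suc i)))) (length (\<alpha> (Suc i)))" "A (Suc (Suc i)) * h' = ?M"
      by (rule mat_lift[OF cAS[of "Suc i"] cM resolution_lift_col[OF R cM z]]) simp_all
    have "A (Suc (Suc i)) * h' * A (Suc (Suc i)) = \<phi> (Suc i) * A (Suc (Suc i)) - h * A (Suc i) * A (Suc (Suc i))"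
      unfolding h'(2) by (rule minus_mult_distrib_mat[OF c\<phi> chA cAS])
    also have "h * A (Suc i) * A (Suc (Suc i)) = 0\<^sub>m (length (\<alpha> (Suc i))) (length (\<alpha> (Suc (Suc i))))"
      using assoc_mult_mat[OF h(1) cAS cAS] resolution_complex[OF R, of "Suc i"] h(1) by simp
    also have "\<phi> (Suc i) * A (Suc (Suc i)) - \<dots> = \<phi> (Suc i) * A (Suc (Suc i))"
      by (rule minus_zero_mat[OF mult_carrier_mat[OF c\<phi> cAS]])
    finally have e: "A (Suc (Suc i)) * h' * A (Suc (Suc i)) = \<phi> (Suc i) * A (Suc (Suc i))" .
    \<comment> \<open>Both terms of
      \<open>\<phi> (Suc i) = A (Suc (Suc i)) * h' + h * A (Suc i)\<close> have a minimal
      differential as a factor, so no constant term survives.\<close>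
    have "Poly_Mapping.lookup (\<phi> (Suc i) $$ (a, b)) 0 = 0"
      if ab: "a < length (\<alpha> (Suc i))" "b < length (\<alpha> (Suc i))" for a b
    proof -
      have "Poly_Mapping.lookup (?M $$ (a, b)) 0 = 0"
        using minL[OF h'(1) ab] h'(2) by simp
      moreover have "Poly_Mapping.lookup ((h * A (Suc i)) $$ (a, b)) 0 = 0"
        using minR[OF h(1) ab] .
      moreover have "?M $$ (a, b) = \<phi> (Suc i) $$ (a, b) - (h * A (Suc i)) $$ (a, b)"
        using index_minus_mat(1) chA ab by (metis carrier_matD)
      ultimately show ?thesis by (simp add: lookup_minus)
    qed
    then show ?case using h'(1) e by blast
  qed
  then show ?thesis using ab by blast
qed

text \<open>A rank argument: \<open>Q\<close> is a left inverse of the matrix \<open>P\<close>, so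
  the columns of \<open>P\<close> are linearly independent in a space spanned by at most
  \<open>card J'\<close> vectors.\<close>

lemma card_le_if_left_inverse:
  fixes P Q :: "'a \<Rightarrow> 'b \<Rightarrow> 'k::field"
  assumes fin: "finite J" "finite J'"
    and inv: "\<And>b b'. b \<in> J \<Longrightarrow> b' \<in> J \<Longrightarrow> (\<Sum>a\<in>J'. Q b a * P b' a) = (if b = b' then 1 else 0)"
  shows "card J \<le> card J'"
proof -
  \<comment> \<open>Finitely supported functions on the index type serve as the vector space;
    \<open>f b\<close> below is column \<open>b\<close> of \<open>P\<close>.\<close>
  define scale :: "'k \<Rightarrow> ('b \<Rightarrow>\<^sub>0 'k) \<Rightarrow> 'b \<Rightarrow>\<^sub>0 'k" where "scale c = Poly_Mapping.map ((*) c)" for c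
  have scale: "Poly_Mapping.lookup (scale c f) a = c * Poly_Mapping.lookup f a" for c f a
    by (simp add: scale_def Poly_Mapping.map.rep_eq when_def)
  interpret V: vector_space scale
    by unfold_locales (rule poly_mapping_eqI, simp add: scale lookup_add algebra_simps)+
  define f where "f b = (\<Sum>a\<in>J'. Poly_Mapping.single a (P b a))" for b
  have f: "Poly_Mapping.lookup (f b) a = (if a \<in> J' then P b a else 0)" for a b
    using fin by (auto simp: f_def lookup_sum lookup_single when_def sum.delta)
  have prod: "(\<Sum>a\<in>J'. Q b a * Poly_Mapping.lookup (f b') a) = (if b = b' then 1 else 0)"
    if "b \<in> J" "b' \<in> J" for b b'
    using inv[OF that] by (simp add: f cong: sum.cong)
  have inj: "inj_on f J"
    using prod by (intro inj_onI) (metis zero_neq_one)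
  have indep: "V.independent (f ` J)"
  proof (rule V.independent_if_scalars_zero)
    show "finite (f ` J)" using fin by simp
    fix c x assume sum: "(\<Sum>x\<in>f ` J. scale (c x) x) = 0" and x: "x \<in> f ` J"
    then obtain b where b: "b \<in> J" "x = f b" by auto
    have "(\<Sum>b'\<in>J. c (f b') * Poly_Mapping.lookup (f b') a) = 0" for a
      using arg_cong[OF sum, of "\<lambda>p. Poly_Mapping.lookup p a"]
      by (simp add: sum.reindex[OF inj] lookup_sum scale)
    then have "0 = (\<Sum>a\<in>J'. Q b a * (\<Sum>b'\<in>J. c (f b') * Poly_Mapping.lookup (f b') a))" by simp
    also have "\<dots> = (\<Sum>b'\<in>J. c (f b') * (\<Sum>a\<in>J'. Q b a * Poly_Mapping.lookup (f b') a))"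
      by (simp add: sum_distrib_left mult_ac sum.swap[of _ J' J])
    also have "\<dots> = (\<Sum>b'\<in>J. if b' = b then c (f b') else 0)"
      by (intro sum.cong refl) (use prod b in auto)
    also have "\<dots> = c x"
      using fin b by simp
    finally show "c x = 0" by simp
  qed
  have "f b \<in> V.span ((\<lambda>a. Poly_Mapping.single a 1) ` J')" for b
  proof -
    have "f b = (\<Sum>a\<in>J'. scale (P b a) (Poly_Mapping.single a 1))"
      unfolding f_def
      by (intro sum.cong refl poly_mapping_eqI) (simp add: scale lookup_single when_def)
    then show ?thesis
      by (simp only:) (rule V.span_sum, rule V.span_scale, rule V.span_base, rule imageI)
  qed
  then have "f ` J \<subseteq> V.span ((\<lambda>a. Poly_Mapping.single a 1) ` J')" by blast
  then have "card (f ` J) \<le> card ((\<lambda>a. Poly_Mapping.single a (1::'k)) ` J')"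
    using V.independent_span_bound[OF _ indep] fin by blast
  also have "\<dots> \<le> card J'" by (rule card_image_le[OF fin(2)])
  finally show ?thesis using card_image[OF inj] by simp
qed

lemma count_list_eq_card: "count_list xs j = card {b. b < length xs \<and> xs ! b = j}"
  by (simp add: count_list_eq_length_filter length_filter_conv_card eq_commute)

text \<open>Lifting the identity of \<open>I\<close> both ways gives \<open>P\<close> and
  \<open>Q\<close>. Then \<open>Q * P\<close> minus the identity lifts zero, so its constant terms
  vanish. Constant entries connect only generators of equal degree, hence the matrices of constant
  terms restrict to the generators of degree \<open>j\<close>, where they form a left inverse.
  Equality follows by exchanging the two resolutions.\<close>

lemma minimal_resolution_count_le:
  fixes I :: "('v::finite, 'k::field) mpoly set"
  assumes RA: "minimal_graded_free_resolution I \<alpha> A" and RB: "minimal_graded_free_resolution I \<beta> B"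
  shows "count_list (\<alpha> i) j \<le> count_list (\<beta> i) j"
proof -
  have A: "graded_free_resolution I \<alpha> A" and B: "graded_free_resolution I \<beta> B"
    using RA RB by (auto simp: minimal_graded_free_resolution_def)
  have one: "mon_degree m = 0" if "m \<in> Poly_Mapping.keys (1 :: ('v, 'k) mpoly)" for m
    using that by (auto simp: mon_degree_def)
  have shift0: "map ((+) 0) xs = xs" for xs :: "nat list"
    by (induction xs) auto
  obtain P where P: "\<And>i. hom_mat (\<beta> i) (\<alpha> i) (P i)" "B 0 * P 0 = A 0"
      "\<And>i. B (Suc i) * P (Suc i) = P i * A (Suc i)"
  proof (rule chain_map_lift[OF A B one])
    fix g assume "\<And>i. hom_mat (\<beta> i) (map ((+) 0) (\<alpha> i)) (g i)" "B 0 * g 0 = 1 \<cdot>\<^sub>m A 0"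
      "\<And>i. B (Suc i) * g (Suc i) = g i * A (Suc i)"
    moreover have "1 \<cdot>\<^sub>m A 0 = A 0" by (intro eq_matI) auto
    ultimately show thesis using that[of g] by (simp only: shift0)
  qed simp_all
  obtain Q where Q: "\<And>i. hom_mat (\<alpha> i) (\<beta> i) (Q i)" "A 0 * Q 0 = B 0"
      "\<And>i. A (Suc i) * Q (Suc i) = Q i * B (Suc i)"
  proof (rule chain_map_lift[OF B A one])
    fix g assume "\<And>i. hom_mat (\<alpha> i) (map ((+) 0) (\<beta> i)) (g i)" "A 0 * g 0 = 1 \<cdot>\<^sub>m B 0"
      "\<And>i. A (Suc i) * g (Suc i) = g i * B (Suc i)"
    moreover have "1 \<cdot>\<^sub>m B 0 = B 0" by (intro eq_matI) auto
    ultimately show thesis using that[of g] by (simp only: shift0)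
  qed simp_all
  note cP = P(1)[THEN hom_mat_carrier] and cQ = Q(1)[THEN hom_mat_carrier]
  note cA = resolutionD(2)[OF A] and cB = resolutionD(2)[OF B]
  have cA0: "A 0 \<in> carrier_mat 1 (length (\<alpha> 0))" and cB0: "B 0 \<in> carrier_mat 1 (length (\<beta> 0))"
    using cA[of 0] cB[of 0] by auto
  have cAS: "A (Suc i) \<in> carrier_mat (length (\<alpha> i)) (length (\<alpha> (Suc i)))"
    and cBS: "B (Suc i) \<in> carrier_mat (length (\<beta> i)) (length (\<beta> (Suc i)))" for i
    using cA[of "Suc i"] cB[of "Suc i"] by auto
  have cQP: "Q i * P i \<in> carrier_mat (length (\<alpha> i)) (length (\<alpha> i))" for i
    using cQ cP by (rule mult_carrier_mat)
  define \<phi> where "\<phi> i = Q i * P i - 1\<^sub>m (length (\<alpha> i))" for i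
  have c\<phi>: "\<phi> i \<in> carrier_mat (length (\<alpha> i)) (length (\<alpha> i))" for i
    unfolding \<phi>_def by (rule minus_carrier_mat) simp
  have \<phi>0: "A 0 * \<phi> 0 = 0\<^sub>m 1 (length (\<alpha> 0))"
  proof -
    have "A 0 * \<phi> 0 = A 0 * (Q 0 * P 0) - A 0 * 1\<^sub>m (length (\<alpha> 0))"
      unfolding \<phi>_def by (rule mult_minus_distrib_mat[OF cA0 cQP]) simp
    also have "A 0 * (Q 0 * P 0) = A 0"
      using assoc_mult_mat[OF cA0 cQ cP] Q(2) P(2) by simp
    also have "A 0 - A 0 * 1\<^sub>m (length (\<alpha> 0)) = 0\<^sub>m 1 (length (\<alpha> 0))"
      using cA0 by (simp add: minus_r_inv_mat[OF cA0])
    finally show ?thesis .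
  qed
  have \<phi>S: "A (Suc i) * \<phi> (Suc i) = \<phi> i * A (Suc i)" for i
  proof -
    have "A (Suc i) * \<phi> (Suc i) = A (Suc i) * (Q (Suc i) * P (Suc i)) - A (Suc i) * 1\<^sub>m (length (\<alpha> (Suc i)))"
      unfolding \<phi>_def by (rule mult_minus_distrib_mat[OF cAS cQP]) simp
    also have "A (Suc i) * (Q (Suc i) * P (Suc i)) = Q i * P i * A (Suc i)"
      using assoc_mult_mat[OF cAS cQ cP] assoc_mult_mat[OF cQ cBS cP] assoc_mult_mat[OF cQ cP cAS]
      by (metis P(3) Q(3))
    also have "A (Suc i) * 1\<^sub>m (length (\<alpha> (Suc i))) = 1\<^sub>m (length (\<alpha> i)) * A (Suc i)"
      using left_mult_one_mat[OF cAS, of i] right_mult_one_mat[OF cAS, of i] by simp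
    also have "Q i * P i * A (Suc i) - \<dots> = \<phi> i * A (Suc i)"
      unfolding \<phi>_def by (rule minus_mult_distrib_mat[OF cQP _ cAS, symmetric]) simp
    finally show ?thesis .
  qed
  let ?c = "\<lambda>p :: ('v, 'k) mpoly. Poly_Mapping.lookup p 0"
  let ?J = "{b. b < length (\<alpha> i) \<and> \<alpha> i ! b = j}" and ?J' = "{a. a < length (\<beta> i) \<and> \<beta> i ! a = j}"
  have "card ?J \<le> card ?J'"
  proof (rule card_le_if_left_inverse[where P = "\<lambda>b a. ?c (P i $$ (a, b))" and Q = "\<lambda>b a. ?c (Q i $$ (b, a))"])
    fix b b' assume b: "b \<in> ?J" "b' \<in> ?J"
    have "?c (\<phi> i $$ (b, b')) = 0"
      by (rule null_homotopic_const[OF RA c\<phi> \<phi>0 \<phi>S]) (use b in auto)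
    moreover have "\<phi> i $$ (b, b') = (Q i * P i) $$ (b, b') - (if b = b' then 1 else 0)"
      using b cQP[of i] unfolding \<phi>_def by (subst index_minus_mat) auto
    ultimately have "?c ((Q i * P i) $$ (b, b')) = (if b = b' then 1 else 0)"
      by (simp add: lookup_minus split: if_splits)
    moreover have "(Q i * P i) $$ (b, b') = (\<Sum>a\<in>{0..<length (\<beta> i)}. Q i $$ (b, a) * P i $$ (a, b'))"
      using b cQ[of i] cP[of i] by (auto simp: scalar_prod_def)
    moreover have "(\<Sum>a\<in>{0..<length (\<beta> i)}. ?c (Q i $$ (b, a)) * ?c (P i $$ (a, b')))
        = (\<Sum>a\<in>?J'. ?c (Q i $$ (b, a)) * ?c (P i $$ (a, b')))"
    \<comment> \<open>A nonzero constant term of \<open>P i\<close> in row \<open>a\<close> and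
      column \<open>b'\<close> forces \<open>\<beta> i ! a = \<alpha> i ! b'\<close>, which is
      \<open>j\<close>; so the rows of other degrees drop out.\<close>
    proof (rule sum.mono_neutral_right)
      show "\<forall>a\<in>{0..<length (\<beta> i)} - ?J'. ?c (Q i $$ (b, a)) * ?c (P i $$ (a, b')) = 0"
      proof
        fix a assume a: "a \<in> {0..<length (\<beta> i)} - ?J'"
        have deg0: "mon_degree (0 :: 'v \<Rightarrow>\<^sub>0 nat) = 0" by (simp add: mon_degree_def)
        have "0 \<notin> Poly_Mapping.keys (P i $$ (a, b'))"
        proof
          assume "0 \<in> Poly_Mapping.keys (P i $$ (a, b'))"
          then have "mon_degree (0 :: 'v \<Rightarrow>\<^sub>0 nat) + \<beta> i ! a = \<alpha> i ! b'"
            using P(1)[of i, unfolded hom_mat_def, THEN conjunct2, rule_format, of a b' 0] a b(2) by simp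
          then have "\<beta> i ! a = \<alpha> i ! b'" by (simp only: deg0 add_0)
          then show False using a b(2) by simp
        qed
        then show "?c (Q i $$ (b, a)) * ?c (P i $$ (a, b')) = 0"
          by (simp add: in_keys_iff)
      qed
    qed auto
    ultimately show "(\<Sum>a\<in>?J'. ?c (Q i $$ (b, a)) * ?c (P i $$ (a, b'))) = (if b = b' then 1 else 0)"
      by (simp add: lookup_sum lookup_const_mult)
  qed simp_all
  then show ?thesis by (simp add: count_list_eq_card)
qed

text \<open>Any one minimal resolution computes the numbers: it supplies a value for
  \<open>THE\<close>, and the two inequalities make that value unique.\<close>

lemma betti_eq_length:
  assumes "minimal_graded_free_resolution I \<delta> D"
  shows "betti I i = length (\<delta> i)"
proof -
  have g: "graded_betti I i j = count_list (\<delta> i) j" for j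
    unfolding graded_betti_def
    by (rule the_equality) (use assms minimal_resolution_count_le in \<open>blast intro: antisym\<close>)+
  \<comment> \<open>Finiteness matters here: a sum over infinitely many degrees would be
    \<open>0\<close> by convention.\<close>
  have "{j. graded_betti I i j \<noteq> 0} = set (\<delta> i)"
    by (auto simp: g count_list_0_iff)
  then show ?thesis
    by (simp add: betti_def g sum_count_set)
qed

section \<open>The mapping cone\<close>

lemma append_vec_empty: "w \<in> carrier_vec 0 \<Longrightarrow> v @\<^sub>v w = v"
  by (intro eq_vecI) auto

lemma zero_mat_mult_vec:
  "v \<in> carrier_vec m \<Longrightarrow> 0\<^sub>m n m *\<^sub>v v = (0\<^sub>v n :: 'a::comm_ring_1 vec)"
  by (intro eq_vecI) auto

lemma smult_mat_mult_vec:
  fixes A :: "'a::comm_ring_1 mat"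
  assumes "A \<in> carrier_mat n m" "v \<in> carrier_vec m"
  shows "(k \<cdot>\<^sub>m A) *\<^sub>v v = k \<cdot>\<^sub>v (A *\<^sub>v v)"
  using assms by (intro eq_vecI) auto

lemma mult_mat_vec_uminus:
  fixes A :: "'a::comm_ring_1 mat"
  assumes "A \<in> carrier_mat n m" "v \<in> carrier_vec m"
  shows "A *\<^sub>v (- v) = - (A *\<^sub>v v)"
  using assms by (intro eq_vecI) auto

lemma carrier_vec_appendE:
  assumes "v \<in> carrier_vec (n + m)"
  obtains a b where "a \<in> carrier_vec n" "b \<in> carrier_vec m" "v = a @\<^sub>v b"
  using vec_first_last_append[OF assms] vec_first_carrier vec_last_carrier by metis

lemma vec_add_eq_iff:
  fixes a :: "'a::ab_group_add vec"
  assumes "a \<in> carrier_vec n" "b \<in> carrier_vec n" "c \<in> carrier_vec n"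
  shows "a + b = c \<longleftrightarrow> a = c + - b" 
proof
  show "a = c + - b" if "a + b = c"
    using assms that[symmetric] by (intro eq_vecI) auto
  show "a + b = c" if "a = c + - b"
    unfolding that using assms by (intro eq_vecI) auto
qed

lemma zero_append_vec: "0\<^sub>v n @\<^sub>v 0\<^sub>v m = 0\<^sub>v (n + m)"
  by (intro eq_vecI) auto

lemma elements_mat_iff: "elements_mat A \<subseteq> X \<longleftrightarrow> (\<forall>i<dim_row A. \<forall>j<dim_col A. A $$ (i, j) \<in> X)"
  using elements_matI[OF carrier_mat_triv[of A]] elements_matD[of _ A] by blast

lemma elements_four_block_subset:
  assumes "A \<in> carrier_mat nr1 nc1" "B \<in> carrier_mat nr1 nc2" "C \<in> carrier_mat nr2 nc1" "D \<in> carrier_mat nr2 nc2"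
    and "elements_mat A \<subseteq> X" "elements_mat B \<subseteq> X" "elements_mat C \<subseteq> X" "elements_mat D \<subseteq> X"
  shows "elements_mat (four_block_mat A B C D) \<subseteq> X"
  using elements_four_block_mat[OF assms(1-4)] assms(5-8) by blast

lemma minimal_resolution_iff:
  "minimal_graded_free_resolution I \<delta> D \<longleftrightarrow>
     graded_free_resolution I \<delta> D \<and> (\<forall>i. elements_mat (D (Suc i)) \<subseteq> ideal_gen (range Var))"
proof -
  have "elements_mat (D (Suc i)) \<subseteq> ideal_gen (range Var) \<longleftrightarrow>
      (\<forall>a<length (\<delta> i). \<forall>b<length (\<delta> (Suc i)). D (Suc i) $$ (a, b) \<in> ideal_gen (range Var))"
    if "graded_free_resolution I \<delta> D" for i
    using resolutionD(2)[OF that, of "Suc i"] by (simp add: elements_mat_iff)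
  then show ?thesis
    by (auto simp: minimal_graded_free_resolution_def)
qed

text \<open>Exactness applied to \<open>u - v\<close>. In a diagram chase this corrects a guessed
  preimage by a boundary.\<close>

lemma resolution_fibreE:
  assumes R: "graded_free_resolution I \<delta> D"
    and c: "u \<in> carrier_vec (length (\<delta> i))" "v \<in> carrier_vec (length (\<delta> i))"
    and eq: "D i *\<^sub>v u = D i *\<^sub>v v"
  obtains s where "s \<in> carrier_vec (length (\<delta> (Suc i)))" "u = D (Suc i) *\<^sub>v s + v"
proof -
  note cD = resolutionD(2)[OF R]
  have uv: "u + - v \<in> carrier_vec (length (\<delta> i))" using c by simp
  have "D i *\<^sub>v (u + - v) = D i *\<^sub>v u + - (D i *\<^sub>v v)"
    using mult_add_distrib_mat_vec[OF cD c(1), of "- v"] mult_mat_vec_uminus[OF cD c(2)] c by simp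
  also have "\<dots> = 0\<^sub>v (length (target_degs \<delta> i))"
    unfolding eq by (rule uminus_r_inv_vec[OF mult_mat_vec_carrier[OF cD c(2)]])
  finally obtain s where s: "s \<in> carrier_vec (length (\<delta> (Suc i)))" "u + - v = D (Suc i) *\<^sub>v s"
    using resolution_kernelE[OF R uv] by metis
  then have "u = D (Suc i) *\<^sub>v s + - (- v)"
    using vec_add_eq_iff[of u "length (\<delta> i)" "- v" "D (Suc i) *\<^sub>v s"] c uv by simp
  then show ?thesis using that s(1) by simp
qed

text \<open>Here \<open>(J + m I) / J\<close> is isomorphic to \<open>m I / x m I\<close>. The mapping cone of the resolutions is
  minimal because the inclusion \<open>x m I = y w I \<subseteq> J\<close> lifts to \<open>y\<close> times a lift of \<open>w I \<subseteq> J\<close>.\<close>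

lemma cone_resolution:
  fixes A B :: "nat \<Rightarrow> ('v::finite, 'k::field) mpoly mat"
  assumes RA: "minimal_graded_free_resolution J \<alpha> A" and RB: "minimal_graded_free_resolution I \<beta> B"
    and m: "m = Poly_Mapping.single t 1" "mon_degree t = d"
    and w: "\<And>k. k \<in> Poly_Mapping.keys w \<Longrightarrow> mon_degree k = d"
    and xy: "Var x * m = Var y * w"
    and sub: "\<And>p. p \<in> I \<Longrightarrow> w * p \<in> J"
    and int: "\<And>p. p \<in> I \<Longrightarrow> m * p \<in> J \<Longrightarrow> \<exists>q\<in>I. p = Var x * q"
  obtains D where "minimal_graded_free_resolution {a - m * p | a p. a \<in> J \<and> p \<in> I}
     (\<lambda>i. \<alpha> i @ map ((+) d) (\<beta> i) @ (case i of 0 \<Rightarrow> [] | Suc j \<Rightarrow> map ((+) (Suc d)) (\<beta> j))) D"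
proof -
  let ?x = "Var x :: ('v, 'k) mpoly" and ?y = "Var y :: ('v, 'k) mpoly"
  let ?M = "ideal_gen (range Var) :: ('v, 'k) mpoly set"
  have resA: "graded_free_resolution J \<alpha> A" and resB: "graded_free_resolution I \<beta> B"
    and elA: "\<And>i. elements_mat (A (Suc i)) \<subseteq> ?M" and elB: "\<And>i. elements_mat (B (Suc i)) \<subseteq> ?M"
    using RA RB by (auto simp: minimal_resolution_iff)
  have xM: "?x \<in> ?M" and yM: "?y \<in> ?M"
    by (simp_all add: ideal_gen_base)
  have deg_single: "mon_degree (Poly_Mapping.single v (1::nat)) = 1" for v :: 'v
    by (simp add: mon_degree_def lookup_single when_def)
  have deg_Var: "mon_degree k = 1" if "k \<in> Poly_Mapping.keys (Var v :: ('v, 'k) mpoly)" for k v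
    using that deg_single by (simp add: Var_def)
  have x_cancel: "p = q" if "?x * p = ?x * q" for p q
    using that unfolding Var_def by (rule monomial_mult_cancel)
  have m_cancel: "p = q" if "m * p = m * q" for p q
    using that unfolding m(1) by (rule monomial_mult_cancel)

  obtain g where g: "\<And>i. hom_mat (\<alpha> i) (map ((+) d) (\<beta> i)) (g i)"
    "A 0 * g 0 = w \<cdot>\<^sub>m B 0" "\<And>i. A (Suc i) * g (Suc i) = g i * B (Suc i)"
    by (rule chain_map_lift[OF resB resA w sub]) auto
  \<comment> \<open>\<open>g\<close> lifts multiplication by \<open>w\<close> from \<open>I\<close>
    to \<open>J\<close>, so \<open>f\<close> lifts multiplication by y w = x m, with the factor
    \<open>y\<close> visible in every entry.\<close>
  define f where "f i = ?y \<cdot>\<^sub>m g i" for i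

  have cA0: "A 0 \<in> carrier_mat 1 (length (\<alpha> 0))" and cB0: "B 0 \<in> carrier_mat 1 (length (\<beta> 0))"
    using resolutionD(2)[OF resA, of 0] resolutionD(2)[OF resB, of 0] by auto
  have cAS: "A (Suc i) \<in> carrier_mat (length (\<alpha> i)) (length (\<alpha> (Suc i)))"
    and cBS: "B (Suc i) \<in> carrier_mat (length (\<beta> i)) (length (\<beta> (Suc i)))" for i
    using resolutionD(2)[OF resA, of "Suc i"] resolutionD(2)[OF resB, of "Suc i"] by auto
  have cg: "g i \<in> carrier_mat (length (\<alpha> i)) (length (\<beta> i))" for i
    using g(1)[of i] hom_mat_carrier by fastforce
  have cf: "f i \<in> carrier_mat (length (\<alpha> i)) (length (\<beta> i))" for i
    using cg by (simp add: f_def)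
  have f0: "A 0 *\<^sub>v (f 0 *\<^sub>v c) = (?x * m) \<cdot>\<^sub>v (B 0 *\<^sub>v c)" if c: "c \<in> carrier_vec (length (\<beta> 0))" for c
  proof -
    have "A 0 *\<^sub>v (f 0 *\<^sub>v c) = ?y \<cdot>\<^sub>v (A 0 *\<^sub>v (g 0 *\<^sub>v c))"
      using mult_mat_vec_smult[OF cA0 mult_mat_vec_carrier[OF cg c]] smult_mat_mult_vec[OF cg c] by (simp add: f_def)
    also have "A 0 *\<^sub>v (g 0 *\<^sub>v c) = w \<cdot>\<^sub>v (B 0 *\<^sub>v c)"
      using assoc_mult_mat_vec[OF cA0 cg c] smult_mat_mult_vec[OF cB0 c] g(2) by simp
    finally show ?thesis by (simp add: smult_smult_assoc xy)
  qed
  have fS: "A (Suc i) *\<^sub>v (f (Suc i) *\<^sub>v c) = f i *\<^sub>v (B (Suc i) *\<^sub>v c)"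
    if c: "c \<in> carrier_vec (length (\<beta> (Suc i)))" for c i
  proof -
    have "A (Suc i) *\<^sub>v (f (Suc i) *\<^sub>v c) = ?y \<cdot>\<^sub>v (A (Suc i) *\<^sub>v (g (Suc i) *\<^sub>v c))"
      using mult_mat_vec_smult[OF cAS mult_mat_vec_carrier[OF cg c]] smult_mat_mult_vec[OF cg c] by (simp add: f_def)
    also have "A (Suc i) *\<^sub>v (g (Suc i) *\<^sub>v c) = g i *\<^sub>v (B (Suc i) *\<^sub>v c)"
      using assoc_mult_mat_vec[OF cAS cg c] assoc_mult_mat_vec[OF cg cBS c] g(3) by simp
    finally show ?thesis
      using smult_mat_mult_vec[OF cg mult_mat_vec_carrier[OF cBS c]] by (simp add: f_def)
  qed

  \<comment> \<open>The modules and differentials of the cone\<close>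
  have plus_fun: "(+) (Suc d) = (\<lambda>n. Suc (d + n))"
    by auto
  \<comment> \<open>Degrees of the third summand, which comes from x m I and sits one homological
    step higher. It is empty at \<open>0\<close>, so that \<open>D (Suc j)\<close> has the same
    block form for all \<open>j\<close>.\<close>
  define \<gamma> where "\<gamma> i = (case i of 0 \<Rightarrow> [] | Suc j \<Rightarrow> map ((+) (Suc d)) (\<beta> j))" for i
  \<comment> \<open>The cone uses the resolution of x m I without its augmentation: at
    \<open>0\<close> the place of \<open>B 0\<close> is taken by the map to the zero module, a
    matrix without rows.\<close>
  define B' where "B' i = (case i of 0 \<Rightarrow> 0\<^sub>m 0 (length (\<beta> 0)) | Suc j \<Rightarrow> - B (Suc j))" for i
  define \<delta> where "\<delta> i = \<alpha> i @ map ((+) d) (\<beta> i) @ \<gamma> i" for i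
  have \<gamma>0: "\<gamma> 0 = []" and \<gamma>S: "\<gamma> (Suc i) = map ((+) (Suc d)) (\<beta> i)" for i
    by (simp_all add: \<gamma>_def)
  have hB': "hom_mat (\<gamma> i) (\<gamma> (Suc i)) (B' i)" for i
  proof (cases i)
    case 0
    then show ?thesis by (simp add: hom_mat_def \<gamma>_def B'_def)
  next
    case (Suc j)
    then show ?thesis
      using hom_mat_uminus[OF hom_mat_shift[OF resolutionD(1)[OF resB, of "Suc j", simplified]]]
      by (simp add: \<gamma>_def B'_def)
  qed
  have cB': "B' i \<in> carrier_mat (length (\<gamma> i)) (length (\<beta> i))" for i
    using hom_mat_carrier[OF hB', of i] by (simp add: \<gamma>S)
  have B'_vec: "B' (Suc i) *\<^sub>v c = - (B (Suc i) *\<^sub>v c)" if "c \<in> carrier_vec (length (\<beta> (Suc i)))" for i c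
    using carrier_matD(2)[OF cBS[of i]] that by (simp add: B'_def uminus_mult_mat_vec)
  \<comment> \<open>On its own, \<open>E\<close> is the differential of the cone of multiplication
    by \<open>x\<close> on \<open>B\<close>, which resolves I / x I; \<open>F\<close> attaches that
    cone to \<open>A\<close>. The sign in \<open>B'\<close> makes consecutive differentials compose
    to zero.\<close>
  define E where "E i = four_block_mat (B (Suc i)) (?x \<cdot>\<^sub>m 1\<^sub>m (length (\<beta> i)))
     (0\<^sub>m (length (\<gamma> i)) (length (\<beta> (Suc i)))) (B' i)" for i
  define F where "F i = four_block_mat (0\<^sub>m (length (\<alpha> i)) (length (\<beta> (Suc i)))) (f i)
     (0\<^sub>m 0 (length (\<beta> (Suc i)))) (0\<^sub>m 0 (length (\<beta> i)))" for i
  \<comment> \<open>With the minus sign in \<open>D 0\<close>, every pair (\<open>f 0\<close> c, x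
    c) is a cycle; for this reason the resolved ideal is written with differences. Blocks without
    rows place two matrices side by side.\<close>
  define D where "D i = (case i of
      0 \<Rightarrow> four_block_mat (A 0) (- (m \<cdot>\<^sub>m B 0)) (0\<^sub>m 0 (length (\<alpha> 0))) (0\<^sub>m 0 (length (\<beta> 0)))
    | Suc j \<Rightarrow> four_block_mat (A (Suc j)) (F j)
        (0\<^sub>m (length (\<beta> j) + length (\<gamma> j)) (length (\<alpha> (Suc j)))) (E j))" for i
  have D0: "D 0 = four_block_mat (A 0) (- (m \<cdot>\<^sub>m B 0)) (0\<^sub>m 0 (length (\<alpha> 0))) (0\<^sub>m 0 (length (\<beta> 0)))"
    and DS: "D (Suc j) = four_block_mat (A (Suc j)) (F j)
        (0\<^sub>m (length (\<beta> j) + length (\<gamma> j)) (length (\<alpha> (Suc j)))) (E j)" for j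
    by (simp_all add: D_def)

  \<comment> \<open>Homogeneity and minimality of the cone\<close>
  have hf: "hom_mat (\<alpha> i) (\<gamma> (Suc i)) (f i)" for i
    using hom_mat_smult[OF g(1)[of i], where w = ?y and d = 1] deg_Var[of _ y] by (simp add: f_def \<gamma>S comp_def plus_fun)
  have hx: "hom_mat (map ((+) d) (\<beta> i)) (\<gamma> (Suc i)) (?x \<cdot>\<^sub>m 1\<^sub>m (length (\<beta> i)))" for i
    using hom_mat_smult[OF hom_mat_one[of "map ((+) d) (\<beta> i)"], where w = ?x and d = 1] deg_Var[of _ x]
    by (simp add: \<gamma>S comp_def plus_fun)
  have hE: "hom_mat (map ((+) d) (\<beta> i) @ \<gamma> i) (map ((+) d) (\<beta> (Suc i)) @ \<gamma> (Suc i)) (E i)" for i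
    unfolding E_def
    using hom_mat_four_block[OF hom_mat_shift[OF resolutionD(1)[OF resB, of "Suc i", simplified]] hx _ hB']
      hom_mat_zero[of "\<gamma> i" "map ((+) d) (\<beta> (Suc i))"] by simp
  have hF: "hom_mat (\<alpha> i) (map ((+) d) (\<beta> (Suc i)) @ \<gamma> (Suc i)) (F i)" for i
    unfolding F_def
    using hom_mat_four_block[OF _ hf, of i "map ((+) d) (\<beta> (Suc i))" _ "[]"]
      hom_mat_zero[of "\<alpha> i" "map ((+) d) (\<beta> (Suc i))"]
      hom_mat_zero[of "[]" "map ((+) d) (\<beta> (Suc i))"] hom_mat_zero[of "[]" "\<gamma> (Suc i)"]
    by (simp add: \<gamma>S)
  have hD: "hom_mat (target_degs \<delta> i) (\<delta> i) (D i)" for i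
  proof (cases i)
    case 0
    have "hom_mat [0] (map ((+) d) (\<beta> 0)) (- (m \<cdot>\<^sub>m B 0))"
      by (rule hom_mat_uminus[OF hom_mat_smult[OF resolutionD(1)[OF resB, of 0, simplified]]])
         (use m in \<open>simp split: if_splits\<close>)
    then have "hom_mat ([0] @ []) (\<alpha> 0 @ map ((+) d) (\<beta> 0)) (D 0)"
      unfolding D0
      using hom_mat_four_block[OF resolutionD(1)[OF resA, of 0, simplified], of _ _ "[]"]
        hom_mat_zero[of "[]" "\<alpha> 0"] hom_mat_zero[of "[]" "map ((+) d) (\<beta> 0)"] by simp
    then show ?thesis using 0 by (simp add: \<delta>_def \<gamma>0)
  next
    case (Suc j)
    then show ?thesis
      using hom_mat_four_block[OF resolutionD(1)[OF resA, of "Suc j", simplified] hF _ hE]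
        hom_mat_zero[of "map ((+) d) (\<beta> j) @ \<gamma> j" "\<alpha> (Suc j)"] by (simp add: DS \<delta>_def)
  qed
  have elD: "elements_mat (D (Suc i)) \<subseteq> ?M" for i
  proof -
    have z: "0 \<in> ?M" by (rule ideal_gen_zero)
    have smult: "elements_mat (k \<cdot>\<^sub>m X) \<subseteq> ?M" if "k \<in> ?M" for k X
      using ideal_gen_mult[OF that] by (simp add: elements_mat_iff mult.commute[of k])
    have zero: "elements_mat (0\<^sub>m n l) \<subseteq> ?M" for n l
      using elements_0_mat z by blast
    have B': "elements_mat (B' i) \<subseteq> ?M"
      using elB by (cases i) (simp_all add: B'_def elements_mat_iff ideal_gen_uminus)
    have E: "elements_mat (E i) \<subseteq> ?M"
      unfolding E_def
      by (rule elements_four_block_subset[OF cBS _ zero_carrier_mat cB' elB smult[OF xM] zero B']) simp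
    have F: "elements_mat (F i) \<subseteq> ?M"
      unfolding F_def
      by (rule elements_four_block_subset[OF zero_carrier_mat cf zero_carrier_mat zero_carrier_mat zero _ zero zero])
         (unfold f_def, rule smult[OF yM])
    have cE: "E i \<in> carrier_mat (length (\<beta> i) + length (\<gamma> i)) (length (\<beta> (Suc i)) + length (\<beta> i))"
      unfolding E_def by (rule four_block_carrier_mat[OF cBS cB'])
    have cF: "F i \<in> carrier_mat (length (\<alpha> i)) (length (\<beta> (Suc i)) + length (\<beta> i))"
      using hom_mat_carrier[OF hF[of i]] by (simp add: \<gamma>S)
    show ?thesis
      unfolding DS by (rule elements_four_block_subset[OF cAS cF zero_carrier_mat cE elA F zero E])
  qed

  \<comment> \<open>The differentials on block vectors\<close>
  have D0_vec: "D 0 *\<^sub>v (a @\<^sub>v b) = A 0 *\<^sub>v a + - (m \<cdot>\<^sub>v (B 0 *\<^sub>v b))"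
    if ab: "a \<in> carrier_vec (length (\<alpha> 0))" "b \<in> carrier_vec (length (\<beta> 0))" for a b
  proof -
    have cmB: "m \<cdot>\<^sub>m B 0 \<in> carrier_mat 1 (length (\<beta> 0))" using cB0 by simp
    have "(- (m \<cdot>\<^sub>m B 0)) *\<^sub>v b = - (m \<cdot>\<^sub>v (B 0 *\<^sub>v b))"
      using cmB ab by (subst uminus_mult_mat_vec) (auto simp: smult_mat_mult_vec[OF cB0])
    moreover have "D 0 *\<^sub>v (a @\<^sub>v b) = (A 0 *\<^sub>v a + (- (m \<cdot>\<^sub>m B 0)) *\<^sub>v b) @\<^sub>v
        (0\<^sub>m 0 (length (\<alpha> 0)) *\<^sub>v a + 0\<^sub>m 0 (length (\<beta> 0)) *\<^sub>v b)"
      unfolding D0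
      by (rule four_block_mat_mult_vec[OF cA0 _ zero_carrier_mat zero_carrier_mat ab]) (use cmB in simp)
    moreover have "0\<^sub>m 0 (length (\<alpha> 0)) *\<^sub>v a + 0\<^sub>m 0 (length (\<beta> 0)) *\<^sub>v b \<in> carrier_vec 0"
      by (intro add_carrier_vec mult_mat_vec_carrier[OF zero_carrier_mat] ab)
    ultimately show ?thesis
      by (simp only: append_vec_empty)
  qed
  have DS_vec: "D (Suc i) *\<^sub>v (a @\<^sub>v (b @\<^sub>v c))
      = (A (Suc i) *\<^sub>v a + f i *\<^sub>v c) @\<^sub>v ((B (Suc i) *\<^sub>v b + ?x \<cdot>\<^sub>v c) @\<^sub>v (B' i *\<^sub>v c))"
    if ab: "a \<in> carrier_vec (length (\<alpha> (Suc i)))" "b \<in> carrier_vec (length (\<beta> (Suc i)))"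
      "c \<in> carrier_vec (length (\<beta> i))" for a b c i
  proof -
    have cE: "E i \<in> carrier_mat (length (\<beta> i) + length (\<gamma> i)) (length (\<beta> (Suc i)) + length (\<beta> i))"
      unfolding E_def by (rule four_block_carrier_mat[OF cBS cB'])
    have cF: "F i \<in> carrier_mat (length (\<alpha> i)) (length (\<beta> (Suc i)) + length (\<beta> i))"
      using hom_mat_carrier[OF hF[of i]] by (simp add: \<gamma>S)
    have bc: "b @\<^sub>v c \<in> carrier_vec (length (\<beta> (Suc i)) + length (\<beta> i))"
      using ab by simp
    have cx: "?x \<cdot>\<^sub>m 1\<^sub>m (length (\<beta> i)) \<in> carrier_mat (length (\<beta> i)) (length (\<beta> i))" by simp
    have E: "E i *\<^sub>v (b @\<^sub>v c) = (B (Suc i) *\<^sub>v b + ?x \<cdot>\<^sub>v c) @\<^sub>v (B' i *\<^sub>v c)"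
      unfolding E_def four_block_mat_mult_vec[OF cBS cx zero_carrier_mat cB' ab(2,3)]
      using smult_mat_mult_vec[OF one_carrier_mat ab(3)] ab mult_mat_vec_carrier[OF cB' ab(3)]
      by (simp add: zero_mat_mult_vec)
    have "F i *\<^sub>v (b @\<^sub>v c) = (0\<^sub>m (length (\<alpha> i)) (length (\<beta> (Suc i))) *\<^sub>v b + f i *\<^sub>v c) @\<^sub>v
       (0\<^sub>m 0 (length (\<beta> (Suc i))) *\<^sub>v b + 0\<^sub>m 0 (length (\<beta> i)) *\<^sub>v c)"
      unfolding F_def
      by (rule four_block_mat_mult_vec[OF zero_carrier_mat cf zero_carrier_mat zero_carrier_mat ab(2,3)])
    also have "\<dots> = 0\<^sub>m (length (\<alpha> i)) (length (\<beta> (Suc i))) *\<^sub>v b + f i *\<^sub>v c"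
      by (intro append_vec_empty add_carrier_vec mult_mat_vec_carrier[OF zero_carrier_mat] ab)
    also have "\<dots> = f i *\<^sub>v c"
      using ab mult_mat_vec_carrier[OF cf ab(3)] by (simp add: zero_mat_mult_vec)
    finally have F: "F i *\<^sub>v (b @\<^sub>v c) = f i *\<^sub>v c" .
    show ?thesis
      unfolding DS four_block_mat_mult_vec[OF cAS cF zero_carrier_mat cE ab(1) bc] E F
      using ab mult_mat_vec_carrier[OF cE bc, unfolded E] by (simp add: zero_mat_mult_vec)
  qed
  have lenS: "length (\<delta> (Suc i)) = length (\<alpha> (Suc i)) + (length (\<beta> (Suc i)) + length (\<beta> i))" for i
    by (simp add: \<delta>_def \<gamma>S)
  have len0: "length (\<delta> 0) = length (\<alpha> 0) + length (\<beta> 0)"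
    by (simp add: \<delta>_def \<gamma>0)
  have DS_E: "\<exists>a b c. v = a @\<^sub>v (b @\<^sub>v c) \<and> a \<in> carrier_vec (length (\<alpha> (Suc i))) \<and>
      b \<in> carrier_vec (length (\<beta> (Suc i))) \<and> c \<in> carrier_vec (length (\<beta> i))"
    if "v \<in> carrier_vec (length (\<delta> (Suc i)))" for v i
    using that unfolding lenS by (metis carrier_vec_appendE)

  \<comment> \<open>Image of the augmentation and exactness\<close>
  have aug: "{a - m * p | a p. a \<in> J \<and> p \<in> I} = (\<lambda>v. (D 0 *\<^sub>v v) $ 0) ` carrier_vec (length (\<delta> 0))"
  proof -
    have val: "(D 0 *\<^sub>v (a @\<^sub>v b)) $ 0 = (A 0 *\<^sub>v a) $ 0 - m * (B 0 *\<^sub>v b) $ 0"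
      if "a \<in> carrier_vec (length (\<alpha> 0))" "b \<in> carrier_vec (length (\<beta> 0))" for a b
      unfolding D0_vec[OF that] using cA0 cB0 that by simp
    show ?thesis
    proof (intro equalityI subsetI)
      fix q assume "q \<in> {a - m * p | a p. a \<in> J \<and> p \<in> I}"
      then obtain a b where ab: "a \<in> carrier_vec (length (\<alpha> 0))" "b \<in> carrier_vec (length (\<beta> 0))"
        "q = (A 0 *\<^sub>v a) $ 0 - m * (B 0 *\<^sub>v b) $ 0"
        using resolutionD(3)[OF resA] resolutionD(3)[OF resB] by blast
      then show "q \<in> (\<lambda>v. (D 0 *\<^sub>v v) $ 0) ` carrier_vec (length (\<delta> 0))"
        unfolding len0 by (intro image_eqI[of _ _ "a @\<^sub>v b"]) (auto simp: val[OF ab(1,2)])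
    next
      fix q assume "q \<in> (\<lambda>v. (D 0 *\<^sub>v v) $ 0) ` carrier_vec (length (\<delta> 0))"
      then obtain v where v: "v \<in> carrier_vec (length (\<delta> 0))" "q = (D 0 *\<^sub>v v) $ 0" by blast
      then obtain a b where ab: "a \<in> carrier_vec (length (\<alpha> 0))" "b \<in> carrier_vec (length (\<beta> 0))" "v = a @\<^sub>v b"
        unfolding len0 by (metis carrier_vec_appendE)
      then show "q \<in> {a - m * p | a p. a \<in> J \<and> p \<in> I}"
        using val[OF ab(1,2)] v(2) resolutionD(3)[OF resA] resolutionD(3)[OF resB] by blast
    qed
  qed

  have exact: "mat_kernel (D i) = (\<lambda>v. D (Suc i) *\<^sub>v v) ` carrier_vec (length (\<delta> (Suc i)))" for i
  proof (cases i)
    case 0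
    have cD: "D 0 \<in> carrier_mat 1 (length (\<delta> 0))"
      using hom_mat_carrier[OF hD[of 0]] by simp
    have D1: "D (Suc 0) *\<^sub>v (a @\<^sub>v (b @\<^sub>v c))
        = (A (Suc 0) *\<^sub>v a + f 0 *\<^sub>v c) @\<^sub>v (B (Suc 0) *\<^sub>v b + ?x \<cdot>\<^sub>v c)"
      if "a \<in> carrier_vec (length (\<alpha> (Suc 0)))" "b \<in> carrier_vec (length (\<beta> (Suc 0)))"
        "c \<in> carrier_vec (length (\<beta> 0))" for a b c
    proof -
      have "B' 0 *\<^sub>v c \<in> carrier_vec 0"
        using mult_mat_vec_carrier[OF cB' that(3)] by (simp add: \<gamma>0)
      then show ?thesis using DS_vec[OF that] by (simp add: append_vec_empty)
    qed
    \<comment> \<open>A cycle (a, b) satisfies \<open>A 0\<close> a = m p with p =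
      \<open>B 0\<close> b. By \<open>int\<close>, p = x q with q in \<open>I\<close>; for a
      preimage c of q under \<open>B 0\<close>, both b - x c and a - \<open>f 0\<close> c are
      cycles, hence boundaries.\<close>
    have "v \<in> (\<lambda>v. D (Suc 0) *\<^sub>v v) ` carrier_vec (length (\<delta> (Suc 0)))" if v: "v \<in> mat_kernel (D 0)" for v
    proof -
      obtain a b where ab: "a \<in> carrier_vec (length (\<alpha> 0))" "b \<in> carrier_vec (length (\<beta> 0))" "v = a @\<^sub>v b"
        using mat_kernelD(1)[OF cD v] unfolding len0 by (metis carrier_vec_appendE)
      have cAa: "A 0 *\<^sub>v a \<in> carrier_vec 1" and cBb: "B 0 *\<^sub>v b \<in> carrier_vec 1"
        using cA0 cB0 ab by auto
      have "A 0 *\<^sub>v a + - (m \<cdot>\<^sub>v (B 0 *\<^sub>v b)) = 0\<^sub>v 1"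
        using mat_kernelD(2)[OF cD v] D0_vec[OF ab(1,2)] ab(3) by simp
      then have Aa: "A 0 *\<^sub>v a = m \<cdot>\<^sub>v (B 0 *\<^sub>v b)"
        using vec_add_eq_iff[OF cAa, of "- (m \<cdot>\<^sub>v (B 0 *\<^sub>v b))" "0\<^sub>v 1"] cBb by simp
      have "(B 0 *\<^sub>v b) $ 0 \<in> I" "(A 0 *\<^sub>v a) $ 0 \<in> J"
        using resolutionD(3)[OF resB] resolutionD(3)[OF resA] ab by blast+
      moreover have "(A 0 *\<^sub>v a) $ 0 = m * (B 0 *\<^sub>v b) $ 0"
        unfolding Aa using cB0 by simp
      ultimately obtain q where q: "q \<in> I" "(B 0 *\<^sub>v b) $ 0 = ?x * q"
        using int by metis
      then obtain c where c: "c \<in> carrier_vec (length (\<beta> 0))" "q = (B 0 *\<^sub>v c) $ 0"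
        using resolutionD(3)[OF resB] by blast
      have cBc: "B 0 *\<^sub>v c \<in> carrier_vec 1" using cB0 c by simp
      have Bb: "B 0 *\<^sub>v b = ?x \<cdot>\<^sub>v (B 0 *\<^sub>v c)"
        using q(2) cB0 unfolding c(2) by (intro eq_vecI) auto
      then have "B 0 *\<^sub>v b = B 0 *\<^sub>v (?x \<cdot>\<^sub>v c)"
        using mult_mat_vec_smult[OF cB0 c(1)] by simp
      then obtain b1 where b1: "b1 \<in> carrier_vec (length (\<beta> (Suc 0)))" "b = B (Suc 0) *\<^sub>v b1 + ?x \<cdot>\<^sub>v c"
        using resolution_fibreE[OF resB ab(2), of "?x \<cdot>\<^sub>v c"] c(1) by (metis smult_carrier_vec)
      have "A 0 *\<^sub>v a = A 0 *\<^sub>v (f 0 *\<^sub>v c)"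
        unfolding Aa Bb f0[OF c(1)] by (simp add: smult_smult_assoc mult.commute)
      then obtain a1 where a1: "a1 \<in> carrier_vec (length (\<alpha> (Suc 0)))" "a = A (Suc 0) *\<^sub>v a1 + f 0 *\<^sub>v c"
        using resolution_fibreE[OF resA ab(1) mult_mat_vec_carrier[OF cf c(1)]] by metis
      have "v = D (Suc 0) *\<^sub>v (a1 @\<^sub>v (b1 @\<^sub>v c))"
        using D1[OF a1(1) b1(1) c(1)] ab(3) a1(2) b1(2) by simp
      then show ?thesis using a1(1) b1(1) c(1) unfolding lenS by blast
    qed
    moreover have "D (Suc 0) *\<^sub>v u \<in> mat_kernel (D 0)" if u: "u \<in> carrier_vec (length (\<delta> (Suc 0)))" for u
    proof -
      obtain a b c where abc: "u = a @\<^sub>v (b @\<^sub>v c)" "a \<in> carrier_vec (length (\<alpha> (Suc 0)))"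
          "b \<in> carrier_vec (length (\<beta> (Suc 0)))" "c \<in> carrier_vec (length (\<beta> 0))"
        using DS_E[OF u] by blast
      let ?a = "A (Suc 0) *\<^sub>v a + f 0 *\<^sub>v c" and ?b = "B (Suc 0) *\<^sub>v b + ?x \<cdot>\<^sub>v c"
      have ca: "A (Suc 0) *\<^sub>v a \<in> carrier_vec (length (\<alpha> 0))" "f 0 *\<^sub>v c \<in> carrier_vec (length (\<alpha> 0))"
        and cb: "B (Suc 0) *\<^sub>v b \<in> carrier_vec (length (\<beta> 0))" "?x \<cdot>\<^sub>v c \<in> carrier_vec (length (\<beta> 0))"
        and cBc: "B 0 *\<^sub>v c \<in> carrier_vec 1"
        using mult_mat_vec_carrier[OF cAS abc(2)] mult_mat_vec_carrier[OF cf abc(4)]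
          mult_mat_vec_carrier[OF cBS abc(3)] mult_mat_vec_carrier[OF cB0 abc(4)] abc(4) by simp_all
      have "A 0 *\<^sub>v ?a = (?x * m) \<cdot>\<^sub>v (B 0 *\<^sub>v c)"
        using mult_add_distrib_mat_vec[OF cA0 ca] resolution_complex_vec[OF resA abc(2)] f0[OF abc(4)] cBc by simp
      moreover have "B 0 *\<^sub>v ?b = ?x \<cdot>\<^sub>v (B 0 *\<^sub>v c)"
        using mult_add_distrib_mat_vec[OF cB0 cb] resolution_complex_vec[OF resB abc(3)]
          mult_mat_vec_smult[OF cB0 abc(4)] cBc by simp
      ultimately have "D 0 *\<^sub>v (?a @\<^sub>v ?b) = (?x * m) \<cdot>\<^sub>v (B 0 *\<^sub>v c) + - ((?x * m) \<cdot>\<^sub>v (B 0 *\<^sub>v c))"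
        using D0_vec[of ?a ?b] ca cb by (simp add: smult_smult_assoc mult.commute)
      also have "\<dots> = 0\<^sub>v 1"
        by (rule uminus_r_inv_vec) (use cBc in simp)
      finally show ?thesis
        unfolding abc(1) D1[OF abc(2-4)]
        by (rule mat_kernelI[OF cD, rotated]) (use ca cb in \<open>simp add: len0\<close>)
    qed
    ultimately show ?thesis unfolding 0 by blast
  next
    case (Suc j)
    have cD: "D (Suc j) \<in> carrier_mat (length (\<delta> j)) (length (\<delta> (Suc j)))"
      using hom_mat_carrier[OF hD[of "Suc j"]] by simp
    have zero: "0\<^sub>v (length (\<delta> j)) = (0\<^sub>v (length (\<alpha> j)) @\<^sub>v (0\<^sub>v (length (\<beta> j)) @\<^sub>v 0\<^sub>v (length (\<gamma> j))) :: ('v, 'k) mpoly vec)"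
      by (simp add: zero_append_vec \<delta>_def)
    have "v \<in> (\<lambda>v. D (Suc (Suc j)) *\<^sub>v v) ` carrier_vec (length (\<delta> (Suc (Suc j))))"
      if v: "v \<in> mat_kernel (D (Suc j))" for v
    proof -
      obtain a b c where abc: "v = a @\<^sub>v (b @\<^sub>v c)" "a \<in> carrier_vec (length (\<alpha> (Suc j)))"
          "b \<in> carrier_vec (length (\<beta> (Suc j)))" "c \<in> carrier_vec (length (\<beta> j))"
        using DS_E[OF mat_kernelD(1)[OF cD v]] by blast
      have cAa: "A (Suc j) *\<^sub>v a \<in> carrier_vec (length (\<alpha> j))" and cfc: "f j *\<^sub>v c \<in> carrier_vec (length (\<alpha> j))"
        and cBb: "B (Suc j) *\<^sub>v b \<in> carrier_vec (length (\<beta> j))" and cxc: "?x \<cdot>\<^sub>v c \<in> carrier_vec (length (\<beta> j))"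
        using mult_mat_vec_carrier[OF cAS abc(2)] mult_mat_vec_carrier[OF cf abc(4)]
          mult_mat_vec_carrier[OF cBS abc(3)] abc(4) by simp_all
      have "(A (Suc j) *\<^sub>v a + f j *\<^sub>v c) @\<^sub>v ((B (Suc j) *\<^sub>v b + ?x \<cdot>\<^sub>v c) @\<^sub>v (B' j *\<^sub>v c))
          = 0\<^sub>v (length (\<alpha> j)) @\<^sub>v (0\<^sub>v (length (\<beta> j)) @\<^sub>v 0\<^sub>v (length (\<gamma> j)))"
        using mat_kernelD(2)[OF cD v] unfolding abc(1) DS_vec[OF abc(2-4)] zero .
      then have eqs: "A (Suc j) *\<^sub>v a + f j *\<^sub>v c = 0\<^sub>v (length (\<alpha> j))"
          "B (Suc j) *\<^sub>v b + ?x \<cdot>\<^sub>v c = 0\<^sub>v (length (\<beta> j))"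
        using append_vec_eq[of "A (Suc j) *\<^sub>v a + f j *\<^sub>v c" "length (\<alpha> j)" "0\<^sub>v (length (\<alpha> j))"]
          append_vec_eq[of "B (Suc j) *\<^sub>v b + ?x \<cdot>\<^sub>v c" "length (\<beta> j)" "0\<^sub>v (length (\<beta> j))"]
          cAa cfc cBb cxc by (metis add_carrier_vec zero_carrier_vec)+
      note cB = resolutionD(2)[OF resB, of j]
      have cBc: "B j *\<^sub>v c \<in> carrier_vec (length (target_degs \<beta> j))"
        by (rule mult_mat_vec_carrier[OF cB abc(4)])
      have "?x \<cdot>\<^sub>v (B j *\<^sub>v c) = B j *\<^sub>v (B (Suc j) *\<^sub>v b + ?x \<cdot>\<^sub>v c)"
        using mult_add_distrib_mat_vec[OF cB cBb cxc] resolution_complex_vec[OF resB abc(3)]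
          mult_mat_vec_smult[OF cB abc(4)] cBc by simp
      also have "\<dots> = 0\<^sub>v (length (target_degs \<beta> j))"
        unfolding eqs(2) using cB by (intro eq_vecI) auto
      finally have xBc: "?x \<cdot>\<^sub>v (B j *\<^sub>v c) = 0\<^sub>v (length (target_degs \<beta> j))" .
      \<comment> \<open>Cancelling \<open>x\<close> yields this for \<open>j = 0\<close> as well,
        where the third component of the kernel equation is empty and says nothing about
        \<open>B 0\<close>.\<close>
      have "B j *\<^sub>v c = 0\<^sub>v (length (target_degs \<beta> j))"
      proof (rule eq_vecI)
        fix k assume k: "k < dim_vec (0\<^sub>v (length (target_degs \<beta> j)) :: ('v, 'k) mpoly vec)"
        have "?x * (B j *\<^sub>v c) $ k = ?x * 0"
          using arg_cong[OF xBc, of "\<lambda>u. u $ k"] k carrier_matD(1)[OF cB] by (simp del: index_mult_mat_vec)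
        then show "(B j *\<^sub>v c) $ k = 0\<^sub>v (length (target_degs \<beta> j)) $ k"
          using x_cancel k by (metis index_zero_vec)
      qed (use cB in simp)
      then obtain e' where e': "e' \<in> carrier_vec (length (\<beta> (Suc j)))" "c = B (Suc j) *\<^sub>v e'"
        using resolution_kernelE[OF resB abc(4)] by blast
      \<comment> \<open>The third component of the cone differential is \<open>- B\<close>, which
        fixes the sign of the preimage.\<close>
      define e where "e = - e'"
      have e: "e \<in> carrier_vec (length (\<beta> (Suc j)))" "B (Suc j) *\<^sub>v e = - c"
        using e' mult_mat_vec_uminus[OF cBS e'(1)] by (simp_all add: e_def)
      have "B (Suc j) *\<^sub>v b = - (?x \<cdot>\<^sub>v c)"
        using eqs(2) vec_add_eq_iff[OF cBb cxc, of "0\<^sub>v (length (\<beta> j))"] cxc by simp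
      also have "\<dots> = B (Suc j) *\<^sub>v (?x \<cdot>\<^sub>v e)"
        unfolding mult_mat_vec_smult[OF cBS e(1)] e(2) by (intro eq_vecI) auto
      finally obtain b1 where b1: "b1 \<in> carrier_vec (length (\<beta> (Suc (Suc j))))"
          "b = B (Suc (Suc j)) *\<^sub>v b1 + ?x \<cdot>\<^sub>v e"
        using resolution_fibreE[OF resB abc(3), of "?x \<cdot>\<^sub>v e"] e(1) by (metis smult_carrier_vec)
      have "A (Suc j) *\<^sub>v a = - (f j *\<^sub>v c)"
        using eqs(1) vec_add_eq_iff[OF cAa cfc, of "0\<^sub>v (length (\<alpha> j))"] cfc by simp
      also have "\<dots> = A (Suc j) *\<^sub>v (f (Suc j) *\<^sub>v e)"
        unfolding fS[OF e(1)] e(2) mult_mat_vec_uminus[OF cf abc(4)] ..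
      finally obtain a1 where a1: "a1 \<in> carrier_vec (length (\<alpha> (Suc (Suc j))))"
          "a = A (Suc (Suc j)) *\<^sub>v a1 + f (Suc j) *\<^sub>v e"
        using resolution_fibreE[OF resA abc(2) mult_mat_vec_carrier[OF cf e(1)]] by metis
      have "v = D (Suc (Suc j)) *\<^sub>v (a1 @\<^sub>v (b1 @\<^sub>v e))"
        unfolding DS_vec[OF a1(1) b1(1) e(1)] B'_vec[OF e(1)] e(2) abc(1) a1(2)[symmetric] b1(2)[symmetric] by simp
      then show ?thesis using a1(1) b1(1) e(1) unfolding lenS by blast
    qed
    moreover have "D (Suc (Suc j)) *\<^sub>v u \<in> mat_kernel (D (Suc j))"
      if u: "u \<in> carrier_vec (length (\<delta> (Suc (Suc j))))" for u
    proof -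
      obtain a b c where abc: "u = a @\<^sub>v (b @\<^sub>v c)" "a \<in> carrier_vec (length (\<alpha> (Suc (Suc j))))"
          "b \<in> carrier_vec (length (\<beta> (Suc (Suc j))))" "c \<in> carrier_vec (length (\<beta> (Suc j)))"
        using DS_E[OF u] by blast
      let ?a = "A (Suc (Suc j)) *\<^sub>v a + f (Suc j) *\<^sub>v c" and ?b = "B (Suc (Suc j)) *\<^sub>v b + ?x \<cdot>\<^sub>v c"
      let ?c = "- (B (Suc j) *\<^sub>v c)"
      have ca: "A (Suc (Suc j)) *\<^sub>v a \<in> carrier_vec (length (\<alpha> (Suc j)))" "f (Suc j) *\<^sub>v c \<in> carrier_vec (length (\<alpha> (Suc j)))"
        and cb: "B (Suc (Suc j)) *\<^sub>v b \<in> carrier_vec (length (\<beta> (Suc j)))" "?x \<cdot>\<^sub>v c \<in> carrier_vec (length (\<beta> (Suc j)))"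
        and cBc: "B (Suc j) *\<^sub>v c \<in> carrier_vec (length (\<beta> j))"
        using mult_mat_vec_carrier[OF cAS abc(2)] mult_mat_vec_carrier[OF cf abc(4)]
          mult_mat_vec_carrier[OF cBS abc(3)] mult_mat_vec_carrier[OF cBS abc(4)] abc(4) by simp_all
      have cfBc: "f j *\<^sub>v (B (Suc j) *\<^sub>v c) \<in> carrier_vec (length (\<alpha> j))"
        by (rule mult_mat_vec_carrier[OF cf cBc])
      have cancel: "(0\<^sub>v n + k \<cdot>\<^sub>v u) + k \<cdot>\<^sub>v (- u) = 0\<^sub>v n" if "u \<in> carrier_vec n"
        for u :: "('v, 'k) mpoly vec" and n k
        using that by (intro eq_vecI) auto
      have 1: "A (Suc j) *\<^sub>v ?a + f j *\<^sub>v ?c = 0\<^sub>v (length (\<alpha> j))"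
        using mult_add_distrib_mat_vec[OF cAS ca] resolution_complex_vec[OF resA abc(2)] fS[OF abc(4)]
          mult_mat_vec_uminus[OF cf cBc] cfBc by simp
      have 2: "B (Suc j) *\<^sub>v ?b + ?x \<cdot>\<^sub>v ?c = 0\<^sub>v (length (\<beta> j))"
        unfolding mult_add_distrib_mat_vec[OF cBS cb] resolution_complex_vec[OF resB abc(3)]
          mult_mat_vec_smult[OF cBS abc(4)] target_degs_simps by (rule cancel[OF cBc])
      have 3: "B' j *\<^sub>v ?c = 0\<^sub>v (length (\<gamma> j))"
      proof (cases j)
        case 0
        then show ?thesis by (auto simp: B'_def \<gamma>0)
      next
        case (Suc k)
        then show ?thesis
          using B'_vec[of ?c k] cBc resolution_complex_vec[OF resB abc(4)]
            mult_mat_vec_uminus[OF cBS[of k], of "B (Suc (Suc k)) *\<^sub>v c"] by (simp add: \<gamma>S)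
      qed
      have "D (Suc j) *\<^sub>v (?a @\<^sub>v (?b @\<^sub>v ?c)) = 0\<^sub>v (length (\<delta> j))"
        using DS_vec[of ?a j ?b ?c] ca cb cBc unfolding 1 2 3 zero by simp
      then show ?thesis
        unfolding abc(1) DS_vec[OF abc(2-4)] B'_vec[OF abc(4)]
        by (rule mat_kernelI[OF cD, rotated]) (use ca cb cBc in \<open>simp add: lenS\<close>)
    qed
    ultimately show ?thesis unfolding Suc by blast
  qed
  have "minimal_graded_free_resolution {a - m * p | a p. a \<in> J \<and> p \<in> I} \<delta> D"
    unfolding minimal_resolution_iff graded_free_resolution_iff using hD aug exact elD by blast
  then show ?thesis using that unfolding \<delta>_def[abs_def] \<gamma>_def by blast
qed

text \<open>The ring as its own resolution starts the induction: a graph without edges has cover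
  ideal (1), which gives b_0 = 1 and all other Betti numbers 0.\<close>

lemma unit_resolution:
  obtains \<delta> and D :: "nat \<Rightarrow> ('v::finite, 'k::field) mpoly mat"
  where "minimal_graded_free_resolution UNIV \<delta> D"
proof -
  define \<delta> :: "nat \<Rightarrow> nat list" where "\<delta> i = (if i = 0 then [0] else [])" for i
  define D :: "nat \<Rightarrow> ('v, 'k) mpoly mat"
    where "D i = (if i = 0 then 1\<^sub>m 1 else 0\<^sub>m (length (\<delta> (i - 1))) 0)" for i
  have "hom_mat (target_degs \<delta> i) (\<delta> i) (D i)" for i
    by (cases i) (auto simp: hom_mat_def \<delta>_def D_def mon_degree_def)
  moreover have "UNIV = (\<lambda>v. (D 0 *\<^sub>v v) $ 0) ` carrier_vec (length (\<delta> 0))"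
  proof -
    have "p \<in> (\<lambda>v. (D 0 *\<^sub>v v) $ 0) ` carrier_vec (length (\<delta> 0))" for p
    proof (rule image_eqI)
      show "p = (D 0 *\<^sub>v vec 1 (\<lambda>_. p)) $ 0" by (simp add: D_def)
      show "vec 1 (\<lambda>_. p) \<in> carrier_vec (length (\<delta> 0))" by (simp add: \<delta>_def)
    qed
    then show ?thesis by (rule UNIV_eq_I)
  qed
  moreover have "mat_kernel (D i) = (\<lambda>v. D (Suc i) *\<^sub>v v) ` carrier_vec (length (\<delta> (Suc i)))" for i
  proof -
    have c0: "v \<in> carrier_vec 0 \<longleftrightarrow> v = 0\<^sub>v 0" for v :: "('v, 'k) mpoly vec"
      by (simp only: carrier_dim_vec vec_of_dim_0)
    have D1: "D (Suc i) *\<^sub>v 0\<^sub>v 0 = 0\<^sub>v (length (\<delta> i))"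
      using zero_mat_mult_vec[OF zero_carrier_vec, of "length (\<delta> i)" 0]
      by (simp add: D_def del: zero_vec_zero)
    have "carrier_vec (length (\<delta> (Suc i))) = {0\<^sub>v 0 :: ('v, 'k) mpoly vec}"
      by (rule Set.set_eqI) (simp only: \<delta>_def nat.distinct if_False list.size c0 singleton_iff)
    then have im: "(\<lambda>v. D (Suc i) *\<^sub>v v) ` carrier_vec (length (\<delta> (Suc i))) = {0\<^sub>v (length (\<delta> i))}"
      by (simp only: image_insert image_empty D1)
    have "v \<in> mat_kernel (D i) \<longleftrightarrow> v = 0\<^sub>v (length (\<delta> i))" for v
    proof (cases i)
      case 0
      have "v \<in> mat_kernel (1\<^sub>m 1) \<longleftrightarrow> v = 0\<^sub>v 1"
        unfolding mat_kernel[OF one_carrier_mat] using one_mult_mat_vec[of v 1] by auto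
      then show ?thesis by (simp add: 0 D_def \<delta>_def)
    next
      case (Suc j)
      have "v \<in> mat_kernel (0\<^sub>m (length (\<delta> j)) 0) \<longleftrightarrow> v = 0\<^sub>v 0"
        unfolding mat_kernel[OF zero_carrier_mat] mem_Collect_eq c0
        using zero_mat_mult_vec[OF zero_carrier_vec] by metis
      moreover have "D i = 0\<^sub>m (length (\<delta> j)) 0" "length (\<delta> i) = 0"
        by (simp_all add: Suc D_def \<delta>_def)
      ultimately show ?thesis by simp
    qed
    then show ?thesis unfolding im by blast
  qed
  moreover have "elements_mat (D (Suc i)) \<subseteq> ideal_gen (range Var)" for i
    by (auto simp: elements_mat_iff D_def)
  ultimately show ?thesis
    using that unfolding minimal_resolution_iff graded_free_resolution_iff by blast
qed

text \<open>Multiplication by a monomial is injective, so m I is resolved by the differentials of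
  \<open>I\<close>; only the augmentation and the degrees change.\<close>

lemma monomial_mult_resolution:
  fixes B :: "nat \<Rightarrow> ('v::finite, 'k::field) mpoly mat"
  assumes RB: "minimal_graded_free_resolution I \<beta> B"
    and m: "m = Poly_Mapping.single t 1" "mon_degree t = d"
  obtains D where "minimal_graded_free_resolution {m * p | p. p \<in> I} (\<lambda>i. map ((+) d) (\<beta> i)) D"
proof -
  have R: "graded_free_resolution I \<beta> B"
    and el: "\<And>i. elements_mat (B (Suc i)) \<subseteq> ideal_gen (range Var)"
    using RB by (auto simp: minimal_resolution_iff)
  have cB0: "B 0 \<in> carrier_mat 1 (length (\<beta> 0))"
    using resolutionD(2)[OF R, of 0] by simp
  define \<delta> where "\<delta> i = map ((+) d) (\<beta> i)" for i
  define D where "D i = (if i = 0 then m \<cdot>\<^sub>m B 0 else B i)" for i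
  have "hom_mat (target_degs \<delta> i) (\<delta> i) (D i)" for i
  proof (cases i)
    case 0
    then show ?thesis
      using hom_mat_smult[OF resolutionD(1)[OF R, of 0], of m d] m
      by (simp add: D_def \<delta>_def split: if_splits)
  next
    case (Suc j)
    then show ?thesis
      using hom_mat_shift[OF resolutionD(1)[OF R, of i]] by (simp add: D_def \<delta>_def)
  qed
  moreover have val: "(D 0 *\<^sub>v v) = m \<cdot>\<^sub>v (B 0 *\<^sub>v v)" if "v \<in> carrier_vec (length (\<beta> 0))" for v
    using smult_mat_mult_vec[OF cB0 that] by (simp add: D_def)
  have "{m * p | p. p \<in> I} = (\<lambda>v. (D 0 *\<^sub>v v) $ 0) ` carrier_vec (length (\<delta> 0))"
  proof -
    have "(D 0 *\<^sub>v v) $ 0 = m * (B 0 *\<^sub>v v) $ 0" if "v \<in> carrier_vec (length (\<beta> 0))" for v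
      unfolding val[OF that] using cB0 by simp
    then have "(\<lambda>v. (D 0 *\<^sub>v v) $ 0) ` carrier_vec (length (\<delta> 0))
        = (\<lambda>v. m * (B 0 *\<^sub>v v) $ 0) ` carrier_vec (length (\<beta> 0))"
      by (simp add: \<delta>_def del: index_mult_mat_vec cong: image_cong)
    then show ?thesis unfolding resolutionD(3)[OF R] by blast
  qed
  moreover have "mat_kernel (D i) = (\<lambda>v. D (Suc i) *\<^sub>v v) ` carrier_vec (length (\<delta> (Suc i)))" for i
  proof (cases i)
    case 0
    have "m \<cdot>\<^sub>v u = 0\<^sub>v 1 \<longleftrightarrow> u = 0\<^sub>v 1" if u: "u \<in> carrier_vec 1" for u
    proof
      assume "m \<cdot>\<^sub>v u = 0\<^sub>v 1"
      then have "(m \<cdot>\<^sub>v u) $ 0 = 0\<^sub>v 1 $ 0" by (rule arg_cong)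
      then have "m * u $ 0 = m * 0" using u by simp
      then have "u $ 0 = 0"
        unfolding m(1) by (rule monomial_mult_cancel)
      then show "u = 0\<^sub>v 1" using u by (intro eq_vecI) auto
    qed auto
    moreover have "D 0 \<in> carrier_mat 1 (length (\<beta> 0))" using cB0 by (simp add: D_def)
    ultimately have "mat_kernel (D 0) = mat_kernel (B 0)"
      using val cB0 unfolding mat_kernel[OF cB0] by (subst mat_kernel) (auto simp: mult_mat_vec_carrier[OF cB0])
    then show ?thesis
      using resolutionD(4)[OF R, of 0] 0 by (simp add: D_def \<delta>_def)
  next
    case (Suc j)
    then show ?thesis
      using resolutionD(4)[OF R, of i] by (simp add: D_def \<delta>_def)
  qed
  moreover have "elements_mat (D (Suc i)) \<subseteq> ideal_gen (range Var)" for i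
    using el by (simp add: D_def)
  ultimately have "minimal_graded_free_resolution {m * p | p. p \<in> I} \<delta> D"
    unfolding minimal_resolution_iff graded_free_resolution_iff by blast
  then show ?thesis using that unfolding \<delta>_def[abs_def] by blast
qed

section \<open>Cover ideals as monomial ideals\<close>

text \<open>Ideal operations become set operations on exponents. \<open>U\<close> is meant to be
  closed under adding exponents, as \<open>cov G\<close> is; otherwise this is merely a linear
  subspace.\<close>

definition mono_ideal :: "('v \<Rightarrow>\<^sub>0 nat) set \<Rightarrow> ('v, 'k::field) mpoly set" where
  "mono_ideal U = {p. Poly_Mapping.keys p \<subseteq> U}"

lemma keys_uminus: "Poly_Mapping.keys (- p) = Poly_Mapping.keys (p :: 'a \<Rightarrow>\<^sub>0 'b::ab_group_add)"
  by (auto simp: in_keys_iff)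

lemma keys_monomial_mult:
  fixes p :: "('v, 'k::field) mpoly"
  shows "Poly_Mapping.keys (Poly_Mapping.single t 1 * p) = (+) t ` Poly_Mapping.keys p"
proof
  show "Poly_Mapping.keys (Poly_Mapping.single t 1 * p) \<subseteq> (+) t ` Poly_Mapping.keys p"
    using keys_mult[of "Poly_Mapping.single t 1" p] by auto
  show "(+) t ` Poly_Mapping.keys p \<subseteq> Poly_Mapping.keys (Poly_Mapping.single t 1 * p)"
    by (auto simp: in_keys_iff lookup_monomial_mult)
qed

lemma mono_ideal_shift:
  "{Poly_Mapping.single t 1 * p | p. p \<in> (mono_ideal W :: ('v, 'k::field) mpoly set)} = mono_ideal ((+) t ` W)"
proof (intro equalityI subsetI)
  fix q :: "('v, 'k) mpoly" assume q: "q \<in> mono_ideal ((+) t ` W)"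
  \<comment> \<open>Division of \<open>q\<close> by the monomial, term by term: \<open>SOME\<close>
    recovers the exponent before the translation by \<open>t\<close>.\<close>
  define p where "p = (\<Sum>k\<in>Poly_Mapping.keys q. Poly_Mapping.single (SOME l. l \<in> W \<and> k = t + l) (Poly_Mapping.lookup q k))"
  have some: "(SOME l. l \<in> W \<and> k = t + l) \<in> W \<and> k = t + (SOME l. l \<in> W \<and> k = t + l)"
    if "k \<in> Poly_Mapping.keys q" for k
    by (rule someI_ex) (use q that in \<open>auto simp: mono_ideal_def\<close>)
  have "Poly_Mapping.single t 1 * p = (\<Sum>k\<in>Poly_Mapping.keys q. Poly_Mapping.single k (Poly_Mapping.lookup q k))"
    unfolding p_def sum_distrib_left mult_single
    by (rule sum.cong) (use some in \<open>auto simp flip: some[THEN conjunct2]\<close>)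
  then have pq: "Poly_Mapping.single t 1 * p = q" using sum_single_keys[of q] by simp
  then have "(+) t ` Poly_Mapping.keys p \<subseteq> (+) t ` W"
    using q keys_monomial_mult[of t p] by (simp add: mono_ideal_def)
  then have "p \<in> mono_ideal W" by (auto simp: mono_ideal_def)
  then show "q \<in> {Poly_Mapping.single t 1 * p | p. p \<in> (mono_ideal W :: ('v, 'k) mpoly set)}"
    using pq by blast
next
  fix q :: "('v, 'k) mpoly"
  assume "q \<in> {Poly_Mapping.single t 1 * p | p. p \<in> (mono_ideal W :: ('v, 'k) mpoly set)}"
  then show "q \<in> mono_ideal ((+) t ` W)"
    by (auto simp: mono_ideal_def keys_monomial_mult intro!: imageI)
qed

text \<open>The terms of a polynomial are distributed according to whether their exponents lie in
  \<open>U\<close>. Differences match the ideal in \<open>cone_resolution\<close>.\<close>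

lemma mono_ideal_diff:
  "{a - p | a p. a \<in> mono_ideal U \<and> p \<in> mono_ideal W} = (mono_ideal (U \<union> W) :: ('v, 'k::field) mpoly set)"
proof (intro equalityI subsetI)
  fix q :: "('v, 'k) mpoly" assume "q \<in> {a - p | a p. a \<in> mono_ideal U \<and> p \<in> mono_ideal W}"
  then obtain a p where "q = a + - p" "a \<in> mono_ideal U" "p \<in> mono_ideal W" by auto
  then show "q \<in> mono_ideal (U \<union> W)"
    using keys_add[of a "- p"] by (auto simp: mono_ideal_def keys_uminus)
next
  fix q :: "('v, 'k) mpoly" assume q: "q \<in> mono_ideal (U \<union> W)"
  define a where "a = (\<Sum>k\<in>Poly_Mapping.keys q. if k \<in> U then Poly_Mapping.single k (Poly_Mapping.lookup q k) else 0)"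
  have a: "Poly_Mapping.lookup a k = (if k \<in> U then Poly_Mapping.lookup q k else 0)" for k
  proof -
    have "Poly_Mapping.lookup a k = (\<Sum>l\<in>Poly_Mapping.keys q. if l = k then
        (if k \<in> U then Poly_Mapping.lookup q k else 0) else 0)"
      unfolding a_def lookup_sum by (rule sum.cong) (auto simp: lookup_single when_def)
    then show ?thesis by (auto simp: sum.delta in_keys_iff)
  qed
  have "a \<in> mono_ideal U" "a - q \<in> mono_ideal W"
    using q by (auto simp: mono_ideal_def in_keys_iff a lookup_minus split: if_splits)
  moreover have "q = a - (a - q)" by simp
  ultimately show "q \<in> {a - p | a p. a \<in> mono_ideal U \<and> p \<in> mono_ideal W}" by blast
qed

text \<open>The exponents of the monomials in J(G). Variables outside \<open>verts G\<close> may
  occur freely, since a graph and its subgraphs share one polynomial ring.\<close>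

definition cov :: "'v graph \<Rightarrow> ('v \<Rightarrow>\<^sub>0 nat) set" where
  "cov G = {k. \<forall>e\<in>edges G. \<exists>v\<in>e. Poly_Mapping.lookup k v \<noteq> 0}"

definition sqfree :: "'v set \<Rightarrow> 'v \<Rightarrow>\<^sub>0 nat" where
  "sqfree C = (\<Sum>v\<in>C. Poly_Mapping.single v 1)"

lemma lookup_sqfree: "finite C \<Longrightarrow> Poly_Mapping.lookup (sqfree C) v = (if v \<in> C then 1 else 0)"
  by (simp add: sqfree_def lookup_sum lookup_single when_def)

lemma prod_Var: "finite C \<Longrightarrow> (\<Prod>v\<in>C. Var v) = (Poly_Mapping.single (sqfree C) 1 :: ('v, 'k::field) mpoly)"
  by (induction C rule: finite_induct) (auto simp: sqfree_def Var_def mult_single)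

lemma minimal_vertex_cover_subset:
  assumes "finite C" "vertex_cover G C"
  obtains C' where "C' \<subseteq> C" "minimal_vertex_cover G C'"
proof -
  let ?S = "{C'. C' \<subseteq> C \<and> vertex_cover G C'}"
  have "finite ?S" "?S \<noteq> {}" using assms by auto
  then obtain C' where "C' \<in> ?S" "\<forall>B\<in>?S. B \<subseteq> C' \<longrightarrow> C' = B"
    using finite_has_minimal[of ?S] by blast
  then show ?thesis
    using that[of C'] unfolding minimal_vertex_cover_def by blast
qed

lemma sqfree_diff:
  assumes "finite C" "\<And>v. v \<in> C \<Longrightarrow> Poly_Mapping.lookup k v \<noteq> 0"
  shows "k = sqfree C + (k - sqfree C)"
  by (rule poly_mapping_eqI) (use assms(2) in \<open>auto simp: lookup_add lookup_minus lookup_sqfree[OF assms(1)] Suc_le_eq\<close>)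

text \<open>If the support of a monomial meets every edge, it contains a minimal vertex cover, whose
  squarefree monomial divides the given one.\<close>

lemma cover_ideal_eq:
  assumes "simple_graph (G :: 'v::finite graph)"
  shows "(cover_ideal G :: ('v, 'k::field) mpoly set) = mono_ideal (cov G)"
proof (intro equalityI)
  have cov_add: "k + l \<in> cov G" if "l \<in> cov G" for k l
    using that by (simp add: cov_def lookup_add) blast
  show "(cover_ideal G :: ('v, 'k) mpoly set) \<subseteq> mono_ideal (cov G)"
    unfolding cover_ideal_def
  proof (rule ideal_gen_subset)
    show "{\<Prod>v\<in>C. Var v | C. minimal_vertex_cover G C} \<subseteq> (mono_ideal (cov G) :: ('v, 'k) mpoly set)"
    proof clarify
      fix C assume "minimal_vertex_cover G C"
      then have "vertex_cover G C" by (simp add: minimal_vertex_cover_def)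
      then have "\<exists>v\<in>e. v \<in> C" if "e \<in> edges G" for e
        using that unfolding vertex_cover_def by blast
      then have "sqfree C \<in> cov G"
        by (simp add: cov_def lookup_sqfree)
      then show "(\<Prod>v\<in>C. Var v) \<in> (mono_ideal (cov G) :: ('v, 'k) mpoly set)"
        by (simp add: prod_Var mono_ideal_def)
    qed
    show "q * p \<in> mono_ideal (cov G)" if "p \<in> mono_ideal (cov G)" for p q :: "('v, 'k) mpoly"
    proof -
      have "k \<in> cov G" if k: "k \<in> Poly_Mapping.keys (q * p)" for k
        using keys_mult[of q p] k \<open>p \<in> mono_ideal (cov G)\<close> cov_add by (fastforce simp: mono_ideal_def)
      then show ?thesis by (auto simp: mono_ideal_def)
    qed
    show "p + q \<in> mono_ideal (cov G)"
      if "p \<in> mono_ideal (cov G)" "q \<in> mono_ideal (cov G)" for p q :: "('v, 'k) mpoly"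
      using that keys_add[of p q] by (auto simp: mono_ideal_def)
  qed (simp add: mono_ideal_def)
  show "mono_ideal (cov G) \<subseteq> (cover_ideal G :: ('v, 'k) mpoly set)"
  proof
    fix p :: "('v, 'k) mpoly" assume p: "p \<in> mono_ideal (cov G)"
    have "Poly_Mapping.single k c \<in> (cover_ideal G :: ('v, 'k) mpoly set)" if k: "k \<in> cov G" for k c
    proof -
      let ?S = "{v \<in> verts G. Poly_Mapping.lookup k v \<noteq> 0}"
      have vc: "vertex_cover G ?S"
        using k assms unfolding vertex_cover_def cov_def simple_graph_def by blast
      obtain C where C: "C \<subseteq> ?S" "minimal_vertex_cover G C"
        using minimal_vertex_cover_subset[OF finite vc] by blast
      have "k = sqfree C + (k - sqfree C)"
        by (rule sqfree_diff) (use C(1) in auto)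
      then have "Poly_Mapping.single k c = Poly_Mapping.single (k - sqfree C) c * (\<Prod>v\<in>C. Var v)"
        by (simp add: prod_Var mult_single add.commute)
      moreover have "(\<Prod>v\<in>C. Var v) \<in> (cover_ideal G :: ('v, 'k) mpoly set)"
        unfolding cover_ideal_def by (rule ideal_gen_base) (use C(2) in blast)
      ultimately show ?thesis
        unfolding cover_ideal_def by (simp only: ideal_gen_mult)
    qed
    note single = this
    have sum: "sum f A \<in> cover_ideal G" if "\<And>a. a \<in> A \<Longrightarrow> f a \<in> (cover_ideal G :: ('v, 'k) mpoly set)"
      for f :: "('v \<Rightarrow>\<^sub>0 nat) \<Rightarrow> ('v, 'k) mpoly" and A
      using that unfolding cover_ideal_def ideal_gen_def by (rule module.span_sum[OF module_mult])
    have keys: "k \<in> cov G" if "k \<in> Poly_Mapping.keys p" for k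
      using p that by (auto simp: mono_ideal_def)
    have "(\<Sum>k\<in>Poly_Mapping.keys p. Poly_Mapping.single k (Poly_Mapping.lookup p k)) \<in> cover_ideal G"
      by (intro sum single keys)
    then show "p \<in> cover_ideal G" by (subst sum_single_keys)
  qed
qed

section \<open>Resolutions from simplicial vertices\<close>

definition simplicial :: "'v graph \<Rightarrow> 'v \<Rightarrow> bool" where
  "simplicial G v \<longleftrightarrow> v \<in> verts G \<and> is_clique G (closed_nbhd G v)"

lemma lookup_sqfree_add: "v \<in> C \<Longrightarrow> Poly_Mapping.lookup (sqfree (C :: 'v::finite set) + k) v \<noteq> 0"
  by (simp add: lookup_add lookup_sqfree)

lemma edge_cases:
  assumes "simple_graph G" "e \<in> edges G" "v \<in> e"
  obtains u where "e = {v, u}" "u \<in> nbhd G v" "u \<noteq> v"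
proof -
  have "card e = 2" "e \<subseteq> verts G" using assms by (auto simp: simple_graph_def)
  then obtain u where "e = {v, u}" "u \<noteq> v"
    using assms(3) by (auto simp: card_2_iff insert_commute)
  then show ?thesis using that[of u] assms \<open>e \<subseteq> verts G\<close> by (auto simp: nbhd_def insert_commute)
qed

lemma nbhd_irrefl: "simple_graph G \<Longrightarrow> v \<notin> nbhd G v"
  by (auto simp: nbhd_def simple_graph_def)

text \<open>An edge that meets N[v] also meets N(v), since an edge at \<open>v\<close> ends in a
  neighbour. Once all neighbours are present, only the edges avoiding N[v] remain to be covered, and
  dividing by the neighbours does not affect these.\<close>

lemma cov_divisible_by_nbhd:
  assumes G: "simple_graph (G :: 'v::finite graph)"
  shows "{k \<in> cov G. \<forall>u\<in>nbhd G v. Poly_Mapping.lookup k u \<noteq> 0}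
    = (+) (sqfree (nbhd G v)) ` cov (remove_verts G (closed_nbhd G v))"
proof (intro equalityI subsetI)
  fix k assume "k \<in> {k \<in> cov G. \<forall>u\<in>nbhd G v. Poly_Mapping.lookup k u \<noteq> 0}"
  then have k: "k \<in> cov G" "\<And>u. u \<in> nbhd G v \<Longrightarrow> Poly_Mapping.lookup k u \<noteq> 0" by auto
  have eq: "k = sqfree (nbhd G v) + (k - sqfree (nbhd G v))"
    by (rule sqfree_diff) (use k(2) in auto)
  have "\<exists>u\<in>e. Poly_Mapping.lookup (k - sqfree (nbhd G v)) u \<noteq> 0"
    if e: "e \<in> edges G" "e \<inter> closed_nbhd G v = {}" for e
  proof -
    obtain u where "u \<in> e" "Poly_Mapping.lookup k u \<noteq> 0" using k(1) e(1) by (auto simp: cov_def)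
    moreover have "u \<notin> nbhd G v" using e(2) \<open>u \<in> e\<close> by (auto simp: closed_nbhd_def)
    ultimately show ?thesis by (auto simp: lookup_minus lookup_sqfree)
  qed
  then have "k - sqfree (nbhd G v) \<in> cov (remove_verts G (closed_nbhd G v))"
    by (simp add: cov_def remove_verts_def)
  then show "k \<in> (+) (sqfree (nbhd G v)) ` cov (remove_verts G (closed_nbhd G v))"
    using eq by blast
next
  fix k assume "k \<in> (+) (sqfree (nbhd G v)) ` cov (remove_verts G (closed_nbhd G v))"
  then obtain l where l: "k = sqfree (nbhd G v) + l" "l \<in> cov (remove_verts G (closed_nbhd G v))" by auto
  have nb: "Poly_Mapping.lookup k u \<noteq> 0" if "u \<in> nbhd G v" for u
    using that by (simp add: l(1) lookup_add lookup_sqfree)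
  have "\<exists>u\<in>e. Poly_Mapping.lookup k u \<noteq> 0" if e: "e \<in> edges G" for e
  proof (cases "e \<inter> closed_nbhd G v = {}")
    case True
    then have "\<exists>u\<in>e. Poly_Mapping.lookup l u \<noteq> 0"
      using l(2) e by (simp add: cov_def remove_verts_def)
    then show ?thesis by (auto simp: l(1) lookup_add)
  next
    case False
    then obtain u where u: "u \<in> e" "u = v \<or> u \<in> nbhd G v" by (auto simp: closed_nbhd_def)
    show ?thesis
    proof (cases "u = v")
      case True
      then show ?thesis using edge_cases[OF G e, of v] u nb by (metis insertCI)
    qed (use u nb in auto)
  qed
  then show "k \<in> {k \<in> cov G. \<forall>u\<in>nbhd G v. Poly_Mapping.lookup k u \<noteq> 0}"
    using nb by (simp add: cov_def)
qed

text \<open>The formula for lengths of resolutions, given resolutions for the smaller graphs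
  \<open>H t\<close>; in this form it serves both the existence proof and the theorem. The
  \<open>case\<close> stands for b_{i-1} with value \<open>0\<close> at \<open>i = 0\<close>, where
  truncated subtraction would yield b_0.\<close>

lemma simplicial_resolution:
  fixes G :: "'v::finite graph" and x :: "nat \<Rightarrow> 'v" and H :: "nat \<Rightarrow> 'v graph"
  assumes G: "simple_graph G" and inj: "inj_on x {1..r}" and nb1: "closed_nbhd G (x 1) = x ` {1..r}"
    and cl: "is_clique G (closed_nbhd G (x 1))"
    and H: "\<And>t. t \<in> {1..r} \<Longrightarrow> H t = remove_verts G (closed_nbhd G (x t))"
    and res: "\<And>t. t \<in> {1..r} \<Longrightarrow>
      minimal_graded_free_resolution (mono_ideal (cov (H t)) :: ('v, 'k::field) mpoly set) (\<beta> t) (B t)"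
  obtains \<delta> D where "minimal_graded_free_resolution (mono_ideal (cov G) :: ('v, 'k) mpoly set) \<delta> D"
    "\<And>i. length (\<delta> i) = (\<Sum>t = 1..r. length (\<beta> t i)) +
        (\<Sum>t = 2..r. case i of 0 \<Rightarrow> 0 | Suc j \<Rightarrow> length (\<beta> t j))"
proof -
  \<comment> \<open>The exponents in the partial sum m_1 J(H_1) + ... + m_s J(H_s).\<close>
  define U where "U s = {k \<in> cov G. \<exists>t\<in>{1..s}. \<forall>u\<in>nbhd G (x t). Poly_Mapping.lookup k u \<noteq> 0}" for s
  define m where "m t = sqfree (nbhd G (x t))" for t
  have "x 1 \<in> x ` {1..r}" using nb1 by (auto simp: closed_nbhd_def)
  then have r: "1 \<le> r" by auto
  have adj: "x s \<in> nbhd G (x t)" if "s \<in> {1..r}" "t \<in> {1..r}" "s \<noteq> t" for s t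
  proof -
    have "x s \<noteq> x t" using inj that by (auto dest: inj_onD)
    then show ?thesis
      using cl that unfolding nb1 is_clique_def nbhd_def by (auto simp: insert_commute)
  qed
  have nb1': "nbhd G (x 1) = x ` {2..r}"
  proof -
    have "{1..r} = insert 1 {2..r}" using r by auto
    then have "closed_nbhd G (x 1) - {x 1} = x ` {2..r} - {x 1}" unfolding nb1 by auto
    moreover have "x 1 \<notin> x ` {2..r}"
    proof
      assume "x 1 \<in> x ` {2..r}"
      then obtain q where q: "x 1 = x q" "q \<in> {2..r}" by blast
      then have "1 = q" using inj_onD[OF inj q(1)] r by auto
      then show False using q(2) by simp
    qed
    ultimately show ?thesis using nbhd_irrefl[OF G] by (auto simp: closed_nbhd_def)
  qed
  have piece: "{k \<in> cov G. \<forall>u\<in>nbhd G (x t). Poly_Mapping.lookup k u \<noteq> 0} = (+) (m t) ` cov (H t)"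
    if "t \<in> {1..r}" for t
    unfolding m_def H[OF that] by (rule cov_divisible_by_nbhd[OF G])
  have U1: "U 1 = (+) (m 1) ` cov (H 1)"
    using piece[of 1] r by (simp add: U_def)
  have US: "U (Suc s) = U s \<union> (+) (m (Suc s)) ` cov (H (Suc s))" if "Suc s \<le> r" for s
    using piece[of "Suc s"] that by (auto simp: U_def atLeastAtMostSuc_conv simp del: image_iff)
  \<comment> \<open>A cover that misses x_t contains N(x_t). One that misses no vertex of the clique
    contains N(x_1), and then t = 1 serves.\<close>
  have Ur: "U r = cov G"
  proof -
    have "k \<in> U r" if k: "k \<in> cov G" for k
    proof (cases "\<exists>t\<in>{1..r}. Poly_Mapping.lookup k (x t) = 0")
      case True
      then obtain t where t: "t \<in> {1..r}" "Poly_Mapping.lookup k (x t) = 0" by blast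
      have "Poly_Mapping.lookup k u \<noteq> 0" if "u \<in> nbhd G (x t)" for u
        using that k t(2) by (auto simp: nbhd_def cov_def)
      then show ?thesis using t k unfolding U_def by blast
    next
      case False
      then have "\<forall>u\<in>nbhd G (x 1). Poly_Mapping.lookup k u \<noteq> 0" unfolding nb1' by auto
      then show ?thesis using r k unfolding U_def by auto
    qed
    then show ?thesis by (auto simp: U_def)
  qed
  have "\<exists>\<delta> D. minimal_graded_free_resolution (mono_ideal (U s) :: ('v, 'k) mpoly set) \<delta> D \<and>
     (\<forall>i. length (\<delta> i) = (\<Sum>t = 1..s. length (\<beta> t i)) +
        (\<Sum>t = 2..s. case i of 0 \<Rightarrow> 0 | Suc j \<Rightarrow> length (\<beta> t j)))" if "1 \<le> s" "s \<le> r" for s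
    using that
  proof (induction s rule: nat_induct_at_least)
    case base
    have one: "1 \<in> {1..r}" using r by simp
    obtain D where "minimal_graded_free_resolution
      {Poly_Mapping.single (m 1) 1 * p | p. p \<in> (mono_ideal (cov (H 1)) :: ('v, 'k) mpoly set)}
      (\<lambda>i. map ((+) (mon_degree (m 1))) (\<beta> 1 i)) D"
      by (rule monomial_mult_resolution[OF res[OF one] refl refl])
    then show ?case
      unfolding mono_ideal_shift U1 by (intro exI conjI) auto
  next
    case (Suc s)
    let ?t = "Suc s" and ?W = "(+) (m (Suc s)) ` cov (H (Suc s))"
    have t: "?t \<in> {1..r}" "1 \<in> {1..r}" "1 \<noteq> ?t" using Suc by auto
    obtain \<alpha> A where A: "minimal_graded_free_resolution (mono_ideal (U s) :: ('v, 'k) mpoly set) \<alpha> A"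
      "\<And>i. length (\<alpha> i) = (\<Sum>t = 1..s. length (\<beta> t i)) +
        (\<Sum>t = 2..s. case i of 0 \<Rightarrow> 0 | Suc j \<Rightarrow> length (\<beta> t j))"
      using Suc by auto
    \<comment> \<open>Chosen so that x_t m_t is x_1 times the monomial of \<open>C\<close>; this
      provides \<open>w\<close>, and \<open>y = x 1\<close>, for the cone.\<close>
    define C where "C = closed_nbhd G (x ?t) - {x 1}"
    have C: "x 1 \<in> closed_nbhd G (x ?t)" "x 1 \<notin> C" "insert (x 1) C = insert (x ?t) (nbhd G (x ?t))"
      "x ?t \<notin> nbhd G (x ?t)"
      using adj[OF t(2,1)] t nbhd_irrefl[OF G] by (auto simp: C_def closed_nbhd_def)
    have sq: "Poly_Mapping.single (x ?t) 1 + m ?t = Poly_Mapping.single (x 1) 1 + sqfree C"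
      using arg_cong[OF C(3), of sqfree] C(2,4) by (simp add: sqfree_def m_def)
    have deg: "mon_degree (sqfree C) = mon_degree (m ?t)"
      using arg_cong[OF sq, of mon_degree] by (simp add: mon_degree_add) (simp add: mon_degree_def lookup_single when_def)
    \<comment> \<open>Membership holds through the first summand, because \<open>C\<close> contains
      N(x_1). An edge that meets N[x_t] meets \<open>C\<close>, or it contains x_1 and then has its
      other end in N(x_1).\<close>
    have sub: "sqfree C + k \<in> U s" if k: "k \<in> cov (H ?t)" for k
    proof -
      have nz: "Poly_Mapping.lookup (sqfree C + k) u \<noteq> 0" if "u \<in> C" for u
        using that by (rule lookup_sqfree_add)
      have n1: "nbhd G (x 1) \<subseteq> C"
      proof
        fix u assume u: "u \<in> nbhd G (x 1)"
        then have "u \<noteq> x 1" using nbhd_irrefl[OF G] by blast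
        obtain q where q: "u = x q" "q \<in> {2..r}" using u unfolding nb1' by blast
        then have "q \<in> {1..r}" by simp
        then have "u \<in> closed_nbhd G (x ?t)"
          using adj[OF _ t(1), of q] q(1) by (cases "q = ?t") (simp_all add: closed_nbhd_def)
        with \<open>u \<noteq> x 1\<close> show "u \<in> C" by (simp add: C_def)
      qed
      have "\<exists>u\<in>e. Poly_Mapping.lookup (sqfree C + k) u \<noteq> 0" if e: "e \<in> edges G" for e
      proof (cases "e \<inter> closed_nbhd G (x ?t) = {}")
        case True
        then have "\<exists>u\<in>e. Poly_Mapping.lookup k u \<noteq> 0"
          using k e unfolding H[OF t(1)] by (simp add: cov_def remove_verts_def)
        then show ?thesis by (auto simp: lookup_add)
      next
        case False
        then obtain u where u: "u \<in> e" "u \<in> closed_nbhd G (x ?t)" by blast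
        show ?thesis
        proof (cases "u = x 1")
          case True
          then obtain v where "e = {x 1, v}" "v \<in> nbhd G (x 1)"
            using edge_cases[OF G e] u(1) by metis
          then show ?thesis using nz n1 by blast
        next
          case False
          then show ?thesis using u nz[of u] by (auto simp: C_def)
        qed
      qed
      then show ?thesis
        unfolding U_def cov_def using nz n1 Suc.hyps by (auto intro!: bexI[of _ 1])
    qed
    \<comment> \<open>Each earlier x_q is adjacent to x_t, while m_t omits x_t, so x_t occurs in
      \<open>k\<close> itself. Lowering its exponent by one keeps \<open>k\<close> in
      \<open>cov (H ?t)\<close>, as no edge of \<open>H ?t\<close> contains x_t.\<close>
    have int: "k - Poly_Mapping.single (x ?t) 1 \<in> cov (H ?t) \<and>
        k = Poly_Mapping.single (x ?t) 1 + (k - Poly_Mapping.single (x ?t) 1)"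
      if k: "k \<in> cov (H ?t)" "m ?t + k \<in> U s" for k
    proof -
      obtain q where q: "q \<in> {1..s}" "\<forall>u\<in>nbhd G (x q). Poly_Mapping.lookup (m ?t + k) u \<noteq> 0"
        using k(2) by (auto simp: U_def)
      then have "Poly_Mapping.lookup (m ?t + k) (x ?t) \<noteq> 0"
        using adj[of ?t q] t(1) by auto
      then have nz: "Poly_Mapping.lookup k (x ?t) \<noteq> 0"
        using C(4) by (simp add: lookup_add m_def lookup_sqfree)
      have "\<exists>u\<in>e. Poly_Mapping.lookup (k - Poly_Mapping.single (x ?t) 1) u \<noteq> 0"
        if e: "e \<in> edges G" "e \<inter> closed_nbhd G (x ?t) = {}" for e
      proof -
        obtain u where u: "u \<in> e" "Poly_Mapping.lookup k u \<noteq> 0"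
          using k(1) e unfolding H[OF t(1)] by (auto simp: cov_def remove_verts_def)
        then have "u \<noteq> x ?t" using e(2) by (auto simp: closed_nbhd_def)
        then show ?thesis using u by (intro bexI[of _ u]) (simp_all add: lookup_minus lookup_single when_def)
      qed
      moreover have "k = Poly_Mapping.single (x ?t) 1 + (k - Poly_Mapping.single (x ?t) 1)"
        using nz by (intro poly_mapping_eqI) (auto simp: lookup_add lookup_minus lookup_single when_def)
      ultimately show ?thesis
        unfolding H[OF t(1)] by (simp add: cov_def remove_verts_def)
    qed
    obtain D where D: "minimal_graded_free_resolution
        {a - Poly_Mapping.single (m ?t) 1 * p | a p. a \<in> (mono_ideal (U s) :: ('v, 'k) mpoly set) \<and> p \<in> mono_ideal (cov (H ?t))}
        (\<lambda>i. \<alpha> i @ map ((+) (mon_degree (m ?t))) (\<beta> ?t i) @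
          (case i of 0 \<Rightarrow> [] | Suc j \<Rightarrow> map ((+) (Suc (mon_degree (m ?t)))) (\<beta> ?t j))) D"
    proof (rule cone_resolution[OF A(1) res[OF t(1)] refl refl, where x = "x ?t" and y = "x 1" and w = "Poly_Mapping.single (sqfree C) 1"])
      show "mon_degree k = mon_degree (m ?t)"
        if "k \<in> Poly_Mapping.keys (Poly_Mapping.single (sqfree C) (1::'k))" for k
        using that deg by simp
      show "Var (x ?t) * Poly_Mapping.single (m ?t) (1::'k) = Var (x 1) * Poly_Mapping.single (sqfree C) 1"
        by (simp only: Var_def mult_single sq)
      show "Poly_Mapping.single (sqfree C) 1 * p \<in> mono_ideal (U s)"
        if "p \<in> mono_ideal (cov (H ?t))" for p :: "('v, 'k) mpoly"
        using that sub by (auto simp: mono_ideal_def keys_monomial_mult)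
      show "\<exists>q\<in>mono_ideal (cov (H ?t)). p = Var (x ?t) * q"
        if p: "p \<in> mono_ideal (cov (H ?t))" "Poly_Mapping.single (m ?t) 1 * p \<in> mono_ideal (U s)"
        for p :: "('v, 'k) mpoly"
      proof -
        have "Poly_Mapping.keys p \<subseteq> (+) (Poly_Mapping.single (x ?t) 1) ` cov (H ?t)"
        proof
          fix k assume "k \<in> Poly_Mapping.keys p"
          then have "k \<in> cov (H ?t)" "m ?t + k \<in> U s"
            using p by (auto simp: mono_ideal_def keys_monomial_mult)
          from int[OF this] show "k \<in> (+) (Poly_Mapping.single (x ?t) 1) ` cov (H ?t)" by blast
        qed
        then have "p \<in> mono_ideal ((+) (Poly_Mapping.single (x ?t) 1) ` cov (H ?t))"
          by (simp add: mono_ideal_def)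
        then show ?thesis
          unfolding mono_ideal_shift[symmetric] Var_def by blast
      qed
    qed (use that in blast)
    have "{a - Poly_Mapping.single (m ?t) 1 * p | a p. a \<in> (mono_ideal (U s) :: ('v, 'k) mpoly set) \<and> p \<in> mono_ideal (cov (H ?t))}
      = {a - q | a q. a \<in> mono_ideal (U s) \<and> q \<in> {Poly_Mapping.single (m ?t) 1 * p | p. p \<in> mono_ideal (cov (H ?t))}}"
      by blast
    also have "\<dots> = mono_ideal (U ?t)"
      unfolding mono_ideal_shift mono_ideal_diff using US[of s] t(1) by simp
    finally have "minimal_graded_free_resolution (mono_ideal (U ?t) :: ('v, 'k) mpoly set)
        (\<lambda>i. \<alpha> i @ map ((+) (mon_degree (m ?t))) (\<beta> ?t i) @
          (case i of 0 \<Rightarrow> [] | Suc j \<Rightarrow> map ((+) (Suc (mon_degree (m ?t)))) (\<beta> ?t j))) D"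
      using D by simp
    moreover have "length (\<alpha> i @ map ((+) (mon_degree (m ?t))) (\<beta> ?t i) @
          (case i of 0 \<Rightarrow> [] | Suc j \<Rightarrow> map ((+) (Suc (mon_degree (m ?t)))) (\<beta> ?t j)))
        = (\<Sum>t = 1..?t. length (\<beta> t i)) + (\<Sum>t = 2..?t. case i of 0 \<Rightarrow> 0 | Suc j \<Rightarrow> length (\<beta> t j))" for i
      using Suc.hyps by (cases i) (simp_all add: A(2))
    ultimately show ?case by blast
  qed
  from this[OF r order_refl] show ?thesis unfolding Ur using that by blast
qed

lemma remove_verts_simps [simp]:
  "verts (remove_verts G A) = verts G - A"
  "e \<in> edges (remove_verts G A) \<longleftrightarrow> e \<in> edges G \<and> e \<inter> A = {}"
  by (simp_all add: remove_verts_def)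

lemma simple_graph_remove_verts: "simple_graph G \<Longrightarrow> simple_graph (remove_verts G A)"
  unfolding simple_graph_def by auto

lemma chordal_remove_verts:
  assumes "chordal G"
  shows "chordal (remove_verts G A)"
proof -
  have "induced_cycle G c" if c: "induced_cycle (remove_verts G A) c" for c
  proof -
    have "c ! i \<notin> A" if "i < length c" for i
      using c nth_mem[OF that] unfolding induced_cycle_def by auto
    then show ?thesis using c unfolding induced_cycle_def by auto
  qed
  then show ?thesis using assms unfolding chordal_def by blast
qed

section \<open>Simplicial vertices of chordal graphs\<close>

text \<open>From a walk of least length no chord and no repetition can be cut out. As
  \<open>E\<close> may fail to be symmetric, only forward chords are excluded.\<close>

lemma shortest_walk:
  assumes walk: "xs \<noteq> []" "hd xs = a" "last xs = b" "successively E xs" "set xs \<subseteq> T"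
  obtains ys where "ys \<noteq> []" "hd ys = a" "last ys = b" "successively E ys" "set ys \<subseteq> T" "distinct ys"
    "\<And>i j. i < j \<Longrightarrow> j < length ys \<Longrightarrow> E (ys ! i) (ys ! j) \<Longrightarrow> j = Suc i"
proof -
  define W where "W ys \<longleftrightarrow> ys \<noteq> [] \<and> hd ys = a \<and> last ys = b \<and> successively E ys \<and> set ys \<subseteq> T" for ys
  have "W xs" using walk by (simp add: W_def)
  then obtain ys where ys: "W ys" and min: "\<And>zs. W zs \<Longrightarrow> length ys \<le> length zs"
    using ex_has_least_nat[of W xs length] by blast
  have succ: "successively E (take i ys)" "successively E (drop i ys)" for i
  proof -
    have "successively E (take i ys @ drop i ys)" using ys by (simp add: W_def)
    then show "successively E (take i ys)" "successively E (drop i ys)"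
      by (simp_all only: successively_append_iff)
  qed
  have shortcut: "W (take (Suc i) ys @ drop j ys)" if "i < j" "j < length ys" "E (ys ! i) (ys ! j)" for i j
  proof -
    have "last (take (Suc i) ys) = ys ! i"
      using that by (simp add: take_Suc_conv_app_nth)
    moreover have "hd (drop j ys) = ys ! j" using that by (simp add: hd_drop_conv_nth)
    moreover have "set (take (Suc i) ys @ drop j ys) \<subseteq> set ys"
      using set_take_subset set_drop_subset by fastforce
    ultimately show ?thesis
      using ys that succ[of "Suc i"] succ[of j] unfolding W_def
      by (auto simp: successively_append_iff hd_append last_append)
  qed
  have chordless: "j = Suc i" if "i < j" "j < length ys" "E (ys ! i) (ys ! j)" for i j
    using min[OF shortcut[OF that]] that by simp
  have "distinct ys"
  proof (rule ccontr)
    assume "\<not> distinct ys"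
    then obtain i j where ij: "i < j" "j < length ys" "ys ! i = ys ! j"
      unfolding distinct_conv_nth by (metis linorder_neqE_nat)
    \<comment> \<open>The loop between the two occurrences is removed. For \<open>i = Suc k\<close>
      this is the shortcut from \<open>k\<close> to \<open>j\<close>, since
      \<open>ys ! i = ys ! j\<close>; for \<open>i = 0\<close> the walk starts at \<open>j\<close>
      instead.\<close>
    let ?zs = "take i ys @ drop j ys"
    have "W ?zs"
    proof (cases i)
      case 0
      then have "hd (drop j ys) = a"
        using ij ys hd_conv_nth[of ys] by (auto simp: hd_drop_conv_nth W_def)
      moreover have "set (drop j ys) \<subseteq> set ys" by (rule set_drop_subset)
      ultimately show ?thesis using 0 ij ys succ(2)[of j] by (auto simp: W_def)
    next
      case (Suc k)
      have "E (ys ! k) (ys ! Suc k)"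
      proof -
        have "\<forall>l. Suc l < length ys \<longrightarrow> E (ys ! l) (ys ! Suc l)"
          using ys by (simp add: W_def successively_conv_nth)
        moreover have "Suc k < length ys" using ij Suc by simp
        ultimately show ?thesis by blast
      qed
      then have "E (ys ! k) (ys ! j)" using ij Suc by simp
      then show ?thesis using shortcut[of k j] ij Suc by simp
    qed
    from min[OF this] show False using ij by simp
  qed
  then show ?thesis using that[of ys] ys chordless unfolding W_def by blast
qed

text \<open>Otherwise a shortest walk from \<open>w\<^sub>1\<close> to \<open>w\<^sub>2\<close> outside \<open>N[v]\<close> would close up with \<open>v\<close> to an induced
  cycle.\<close>

lemma chordal_attachments_adjacent:
  assumes G: "simple_graph G" "chordal G"
    and w: "w1 \<in> nbhd G v" "w2 \<in> nbhd G v" "w1 \<noteq> w2"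
    and k: "{w1, k1} \<in> edges G" "{w2, k2} \<in> edges G" "k1 \<in> verts G - closed_nbhd G v"
    and path: "(k1, k2) \<in> {(a, b). {a, b} \<in> edges G \<and> b \<in> verts G - closed_nbhd G v}\<^sup>*"
  shows "{w1, w2} \<in> edges G"
proof (rule ccontr)
  assume na: "{w1, w2} \<notin> edges G"
  let ?E = "\<lambda>a b. {a, b} \<in> edges G"
  let ?O = "verts G - closed_nbhd G v"
  have "\<exists>xs. xs \<noteq> [] \<and> hd xs = k1 \<and> last xs = k2 \<and> successively ?E xs \<and> set xs \<subseteq> ?O"
    using path
  proof (induction rule: rtrancl_induct)
    case base
    then show ?case using k(3) by (intro exI[of _ "[k1]"]) simp
  next
    case (step b c)
    then obtain xs where "xs \<noteq> []" "hd xs = k1" "last xs = b" "successively ?E xs" "set xs \<subseteq> ?O" by blast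
    then show ?case using step(2)
      by (intro exI[of _ "xs @ [c]"]) (auto simp: successively_append_iff)
  qed
  then obtain xs where xs: "xs \<noteq> []" "hd xs = k1" "last xs = k2" "successively ?E xs" "set xs \<subseteq> ?O"
    by blast
  have "successively ?E (w1 # xs @ [w2])"
    using xs k(1,2) by (auto simp: successively_Cons successively_append_iff insert_commute)
  \<comment> \<open>Confined to this set, the walk meets N(v) only in \<open>w1\<close> and
    \<open>w2\<close>, so closing it up with \<open>v\<close> creates no chord at
    \<open>v\<close>.\<close>
  then obtain ys where ys: "ys \<noteq> []" "hd ys = w1" "last ys = w2" "successively ?E ys"
      "set ys \<subseteq> ?O \<union> {w1, w2}" "distinct ys"
      and ch: "\<And>i j. i < j \<Longrightarrow> j < length ys \<Longrightarrow> ?E (ys ! i) (ys ! j) \<Longrightarrow> j = Suc i"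
    using shortest_walk[of "w1 # xs @ [w2]" w1 w2 ?E "?O \<union> {w1, w2}"] xs(5) by auto
  define n where "n = length ys"
  have y0: "ys ! 0 = w1" and yl: "ys ! (n - 1) = w2"
    using ys by (simp_all add: hd_conv_nth last_conv_nth n_def)
  have adjS: "?E (ys ! i) (ys ! Suc i)" if "Suc i < n" for i
    using ys(4) that by (simp add: successively_conv_nth n_def)
  \<comment> \<open>Since \<open>w1\<close> and \<open>w2\<close> are not adjacent, the walk has an
    inner vertex, and the cycle through \<open>v\<close> has length at least 4.\<close>
  have n: "3 \<le> n"
  proof (rule ccontr)
    assume "\<not> 3 \<le> n"
    moreover have "n \<noteq> 0" using ys(1) by (simp add: n_def)
    moreover have "n \<noteq> 1" using y0 yl w(3) by auto
    ultimately have "n = 2" by simp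
    then show False using adjS[of 0] y0 yl na by simp
  qed
  have noloop: "{a} \<notin> edges G" for a
    using G(1) by (fastforce simp: simple_graph_def)
  have yy: "?E (ys ! i) (ys ! j) \<longleftrightarrow> j = Suc i \<or> i = Suc j" if ij: "i < n" "j < n" for i j
  proof
    assume e: "?E (ys ! i) (ys ! j)"
    then have "i \<noteq> j" using noloop by auto
    then show "j = Suc i \<or> i = Suc j"
      using ch[of i j] ch[of j i] e ij by (auto simp: n_def insert_commute linorder_neq_iff)
  next
    assume "j = Suc i \<or> i = Suc j"
    then show "?E (ys ! i) (ys ! j)" using adjS ij by (auto simp: insert_commute)
  qed
  have vy: "?E v (ys ! j) \<longleftrightarrow> j = 0 \<or> j = n - 1" if j: "j < n" for j
  proof
    assume e: "?E v (ys ! j)"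
    have "ys ! j \<in> verts G" using G(1) e by (auto simp: simple_graph_def)
    then have "ys ! j \<in> nbhd G v" using e by (simp add: nbhd_def insert_commute)
    then have "ys ! j = w1 \<or> ys ! j = w2"
      using subsetD[OF ys(5) nth_mem[of j]] j by (auto simp: closed_nbhd_def n_def)
    then have "ys ! j = ys ! 0 \<or> ys ! j = ys ! (n - 1)" using y0 yl by simp
    then show "j = 0 \<or> j = n - 1"
      using nth_eq_iff_index_eq[OF ys(6), of j 0] nth_eq_iff_index_eq[OF ys(6), of j "n - 1"] j ys(1) by (auto simp: n_def)
  next
    assume "j = 0 \<or> j = n - 1"
    then show "?E v (ys ! j)" using y0 yl w by (auto simp: nbhd_def insert_commute)
  qed
  have v: "v \<notin> set ys" "v \<in> verts G"
  proof -
    have "v \<noteq> w1" "v \<noteq> w2" using w nbhd_irrefl[OF G(1)] by auto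
    then show "v \<notin> set ys" using ys(5) by (auto simp: closed_nbhd_def)
    have "{w1, v} \<in> edges G" using w(1) by (simp add: nbhd_def)
    then show "v \<in> verts G" using G(1) by (auto simp: simple_graph_def)
  qed
  have "induced_cycle G (v # ys)"
    unfolding induced_cycle_def
  proof (intro conjI allI impI)
    show "3 \<le> length (v # ys)" using n by (simp add: n_def)
    show "distinct (v # ys)" using v ys by simp
    show "set (v # ys) \<subseteq> verts G" using v ys(5) w by (auto simp: nbhd_def)
    fix i j assume ij: "i < length (v # ys)" "j < length (v # ys)"
    \<comment> \<open>Positions in \<open>v # ys\<close> are those in \<open>ys\<close> moved by
      one; the successor wraps around to \<open>v\<close> exactly at the end of
      \<open>ys\<close>.\<close>
    have mod_eq: "Suc (Suc l) mod Suc n = (if l = n - 1 then 0 else Suc (Suc l))" if "l < n" for l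
      using that n by auto
    show "?E ((v # ys) ! i) ((v # ys) ! j) \<longleftrightarrow>
      j = Suc i mod length (v # ys) \<or> i = Suc j mod length (v # ys)"
    proof (cases i; cases j)
      assume "i = 0" "j = 0"
      then show ?thesis using noloop n ys(1) by (simp add: n_def)
    next
      fix j' assume "i = 0" "j = Suc j'"
      then show ?thesis using vy[of j'] mod_eq[of j'] ij n by (auto simp: n_def)
    next
      fix i' assume "i = Suc i'" "j = 0"
      then show ?thesis using vy[of i'] mod_eq[of i'] ij n by (auto simp: n_def insert_commute)
    next
      fix i' j' assume "i = Suc i'" "j = Suc j'"
      then show ?thesis using yy[of i' j'] mod_eq[of i'] mod_eq[of j'] ij n by (auto simp: n_def)
    qed
  qed
  moreover have "length (v # ys) > 3" using n by (simp add: n_def)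
  ultimately show False using G(2) unfolding chordal_def by blast
qed

text \<open>Dirac's theorem in the strengthened form that lends itself to induction: the vertices outside
  \<open>N[v]\<close> contain a simplicial one. Restrict to a component \<open>K\<close> of the complement of \<open>N[v]\<close> together
  with its attachment set \<open>W \<subseteq> N(v)\<close>, which is a clique.\<close>

lemma simplicial_outside:
  assumes "simple_graph G" "chordal G" "v \<in> verts G" "u \<in> verts G - closed_nbhd G v" "finite (verts G)"
  shows "\<exists>s. simplicial G s \<and> s \<notin> closed_nbhd G v"
  using assms
proof (induction "card (verts G)" arbitrary: G v u rule: less_induct)
  case less
  note G = less.prems(1,2)
  let ?O = "verts G - closed_nbhd G v"
  let ?R = "{(a, b). {a, b} \<in> edges G \<and> b \<in> ?O}"
  define K where "K = {k. (u, k) \<in> ?R\<^sup>*}"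
  define W where "W = {w \<in> nbhd G v. \<exists>k\<in>K. {w, k} \<in> edges G}"
  have uK: "u \<in> K" by (simp add: K_def)
  have KO: "k \<in> ?O" if "k \<in> K" for k
    using that less.prems(4) unfolding K_def by (auto elim: rtranclE)
  \<comment> \<open>Because neighbourhoods of vertices of \<open>K\<close> stay inside
    \<open>K \<union> W\<close>, a vertex of \<open>K\<close> that is simplicial in the subgraph on
    \<open>K \<union> W\<close> is simplicial in \<open>G\<close>.\<close>
  have nb: "nbhd G k \<subseteq> K \<union> W" if k: "k \<in> K" for k
  proof
    fix y assume y: "y \<in> nbhd G k"
    then have e: "{k, y} \<in> edges G" "y \<in> verts G" by (auto simp: nbhd_def insert_commute)
    have "y \<noteq> v" using e KO[OF k] by (auto simp: closed_nbhd_def nbhd_def)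
    show "y \<in> K \<union> W"
    proof (cases "y \<in> nbhd G v")
      case True
      then show ?thesis using e k by (auto simp: W_def insert_commute)
    next
      case False
      then have "(k, y) \<in> ?R" using e \<open>y \<noteq> v\<close> by (simp add: closed_nbhd_def)
      then show ?thesis using k unfolding K_def by (auto intro: rtrancl_into_rtrancl)
    qed
  qed
  \<comment> \<open>\<open>?R\<close> demands only that a step ends in \<open>?O\<close>; reversing
    a step uses that \<open>K\<close> lies in \<open>?O\<close>.\<close>
  have to_u: "(k, u) \<in> ?R\<^sup>*" if "k \<in> K" for k
  proof -
    have "(u, k) \<in> ?R\<^sup>*" using that by (simp add: K_def)
    then show ?thesis
    proof (induction rule: rtrancl_induct)
      case (step b c)
      have "b \<in> K" using step(1) unfolding K_def by (rule CollectI)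
      then have "b \<in> ?O" by (rule KO)
      then have "(c, b) \<in> ?R" using step(2) by (simp add: insert_commute)
      then show ?case using step(3) by (rule converse_rtrancl_into_rtrancl)
    qed simp
  qed
  have W: "{w1, w2} \<in> edges G" if w: "w1 \<in> W" "w2 \<in> W" "w1 \<noteq> w2" for w1 w2
  proof -
    obtain k1 k2 where k: "k1 \<in> K" "{w1, k1} \<in> edges G" "k2 \<in> K" "{w2, k2} \<in> edges G"
      using w by (auto simp: W_def)
    have "(k1, k2) \<in> ?R\<^sup>*" using to_u[OF k(1)] k(3) unfolding K_def by (auto intro: rtrancl_trans)
    then show ?thesis
      using chordal_attachments_adjacent[OF G _ _ w(3) k(2,4) KO[OF k(1)]] w by (simp add: W_def)
  qed
  have KWG: "K \<union> W \<subseteq> verts G" using KO by (auto simp: W_def nbhd_def)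
  have simpl: "simplicial G s" if s: "s \<in> K" and c: "is_clique G (closed_nbhd G s)" for s
    using c KO[OF s] by (simp add: simplicial_def)
  show ?case
  proof (cases "is_clique G (K \<union> W)")
    case True
    have "closed_nbhd G u \<subseteq> K \<union> W" using nb[OF uK] uK by (simp add: closed_nbhd_def)
    then have "is_clique G (closed_nbhd G u)" using True unfolding is_clique_def by blast
    then show ?thesis using simpl[OF uK] KO[OF uK] by blast
  next
    case False
    then obtain a b where ab: "a \<in> K \<union> W" "b \<in> K \<union> W" "a \<noteq> b" "{a, b} \<notin> edges G"
      using KWG unfolding is_clique_def by blast
    define G' where "G' = remove_verts G (verts G - (K \<union> W))"
    have vG': "verts G' = K \<union> W" using KWG by (auto simp: G'_def)
    have eG': "{p, q} \<in> edges G' \<longleftrightarrow> {p, q} \<in> edges G" if "p \<in> K \<union> W" "q \<in> K \<union> W" for p q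
      using that by (auto simp: G'_def)
    \<comment> \<open>The new base vertex \<open>z\<close> needs all its non-neighbours in
      \<open>K\<close>, so that the induction hypothesis returns a vertex of \<open>K\<close> and
      not of \<open>W\<close>. A vertex of \<open>W\<close> with a non-neighbour qualifies because
      \<open>W\<close> is a clique; if there is none, each vertex of \<open>W\<close> is adjacent to
      all others, and \<open>a\<close> qualifies.\<close>
    have "\<exists>z y. z \<in> K \<union> W \<and> y \<in> K \<union> W \<and> y \<noteq> z \<and> {z, y} \<notin> edges G \<and>
        (\<forall>s\<in>K \<union> W. s \<noteq> z \<longrightarrow> {z, s} \<notin> edges G \<longrightarrow> s \<in> K)"
    proof (cases "\<exists>z\<in>W. \<exists>y\<in>K \<union> W. y \<noteq> z \<and> {z, y} \<notin> edges G")
      case True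
      then obtain z y where "z \<in> W" "y \<in> K \<union> W" "y \<noteq> z" "{z, y} \<notin> edges G" by blast
      then show ?thesis using W by blast
    next
      case False
      then have "\<forall>s\<in>K \<union> W. s \<noteq> a \<longrightarrow> {a, s} \<notin> edges G \<longrightarrow> s \<in> K"
        using ab(1) by (metis UnE insert_commute)
      then show ?thesis using ab by blast
    qed
    then obtain z y where z: "z \<in> K \<union> W" "y \<in> K \<union> W" "y \<noteq> z" "{z, y} \<notin> edges G"
      "\<And>s. s \<in> K \<union> W \<Longrightarrow> s \<noteq> z \<Longrightarrow> {z, s} \<notin> edges G \<Longrightarrow> s \<in> K" by blast
    have nb_iff: "s \<in> closed_nbhd G' z \<longleftrightarrow> s = z \<or> {z, s} \<in> edges G" if "s \<in> K \<union> W" for s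
      using that z(1) eG'[of s z] by (auto simp: closed_nbhd_def nbhd_def vG' insert_commute)
    have "v \<notin> K \<union> W" using KO nbhd_irrefl[OF G(1)] by (auto simp: closed_nbhd_def W_def)
    then have "verts G' \<subset> verts G" using KWG less.prems(3) vG' by blast
    then have "card (verts G') < card (verts G)"
      using less.prems(5) by (simp add: psubset_card_mono)
    moreover have "simple_graph G'" "chordal G'"
      unfolding G'_def using G by (simp_all add: simple_graph_remove_verts chordal_remove_verts)
    moreover have "z \<in> verts G'" "y \<in> verts G' - closed_nbhd G' z"
      using z nb_iff[of y] by (auto simp: vG')
    moreover have "finite (verts G')"
      using vG' KWG less.prems(5) finite_subset by metis
    ultimately obtain s where s: "simplicial G' s" "s \<notin> closed_nbhd G' z"
      using less.hyps by blast
    have sKW: "s \<in> K \<union> W" using s(1) by (simp add: simplicial_def vG')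
    then have sK: "s \<in> K" using z(5)[of s] nb_iff[of s] s(2) by blast
    have sub: "closed_nbhd G s \<subseteq> K \<union> W" using nb[OF sK] sK by (simp add: closed_nbhd_def)
    have "closed_nbhd G s \<subseteq> closed_nbhd G' s"
      using sub sKW eG' unfolding closed_nbhd_def nbhd_def vG' by auto
    then have "is_clique G (closed_nbhd G s)"
      using s(1) sub KWG eG' unfolding simplicial_def is_clique_def vG' by (meson subset_iff)
    then show ?thesis using simpl[OF sK] KO[OF sK] by blast
  qed
qed

text \<open>A vertex with a non-neighbour reduces this to \<open>simplicial_outside\<close>; if
  there is none, the graph is complete and any vertex will do.\<close>

lemma chordal_simplicial_exists:
  assumes "simple_graph G" "chordal G" "verts G \<noteq> {}"
  shows "\<exists>s. simplicial G s"
proof (cases "\<exists>v\<in>verts G. \<exists>u\<in>verts G. u \<notin> closed_nbhd G v")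
  case True
  then obtain v u where "v \<in> verts G" "u \<in> verts G - closed_nbhd G v" by blast
  moreover have "finite (verts G)" using assms(1) by (simp add: simple_graph_def)
  ultimately show ?thesis using simplicial_outside[OF assms(1,2)] by metis
next
  case False
  then have e: "{u, v} \<in> edges G" if "u \<in> verts G" "v \<in> verts G" "u \<noteq> v" for u v
    using that by (auto simp: closed_nbhd_def nbhd_def)
  obtain v where "v \<in> verts G" using assms(3) by blast
  then have "simplicial G v"
    using e by (auto simp: simplicial_def is_clique_def closed_nbhd_def nbhd_def)
  then show ?thesis ..
qed

lemma card_remove_closed_nbhd:
  assumes "simple_graph G" "v \<in> verts G"
  shows "card (verts (remove_verts G (closed_nbhd G v))) < card (verts G)"
proof (rule psubset_card_mono)
  show "finite (verts G)" using assms(1) by (simp add: simple_graph_def)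
  show "verts (remove_verts G (closed_nbhd G v)) \<subset> verts G"
    using assms(2) by (auto simp: closed_nbhd_def)
qed

lemma chordal_resolution_exists:
  fixes G :: "'v::finite graph"
  assumes "simple_graph G" "chordal G"
  shows "\<exists>\<delta> D. minimal_graded_free_resolution (mono_ideal (cov G) :: ('v, 'k::field) mpoly set) \<delta> D"
  using assms
proof (induction "card (verts G)" arbitrary: G rule: less_induct)
  case less
  note G = less.prems
  show ?case
  proof (cases "verts G = {}")
    case True
    then have "edges G = {}" using G(1) by (fastforce simp: simple_graph_def)
    then have "mono_ideal (cov G) = (UNIV :: ('v, 'k) mpoly set)"
      by (auto simp: cov_def mono_ideal_def)
    then show ?thesis using unit_resolution by metis
  next
    case False
    then obtain v where v: "v \<in> verts G" "is_clique G (closed_nbhd G v)"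
      using chordal_simplicial_exists[OF G] by (auto simp: simplicial_def)
    obtain ys where ys: "set ys = nbhd G v" "distinct ys"
      using finite_distinct_list[of "nbhd G v"] by auto
    define xs where "xs = v # ys"
    have xs: "set xs = closed_nbhd G v" "distinct xs"
      using ys nbhd_irrefl[OF G(1)] by (auto simp: xs_def closed_nbhd_def)
    \<comment> \<open>List positions are renumbered from \<open>1\<close>, with \<open>v\<close> at
      the head, because \<open>simplicial_resolution\<close> expects the simplicial vertex as
      \<open>x 1\<close>.\<close>
    define x where "x t = xs ! (t - 1)" for t
    define H where "H t = remove_verts G (closed_nbhd G (x t))" for t
    have x1: "x 1 = v" by (simp add: x_def xs_def)
    have inj: "inj_on x {1..length xs}"
      using xs(2) by (auto simp: inj_on_def x_def nth_eq_iff_index_eq)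
    have img: "x ` {1..length xs} = set xs"
    proof -
      have "{1..length xs} = Suc ` {..<length xs}" by (simp only: image_Suc_lessThan)
      then have "x ` {1..length xs} = (!) xs ` {..<length xs}" by (simp add: x_def image_image)
      then show ?thesis by (auto simp: set_conv_nth)
    qed
    have "\<exists>\<beta> B. minimal_graded_free_resolution (mono_ideal (cov (H t)) :: ('v, 'k) mpoly set) \<beta> B"
      if t: "t \<in> {1..length xs}" for t
    proof (rule less.hyps)
      have "x t \<in> verts G" using t img xs(1) v by (auto simp: is_clique_def)
      then show "card (verts (H t)) < card (verts G)"
        unfolding H_def by (rule card_remove_closed_nbhd[OF G(1)])
    qed (use G in \<open>simp_all add: H_def simple_graph_remove_verts chordal_remove_verts\<close>)
    then obtain \<beta> B where
      "\<And>t. t \<in> {1..length xs} \<Longrightarrow> minimal_graded_free_resolution (mono_ideal (cov (H t)) :: ('v, 'k) mpoly set) (\<beta> t) (B t)"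
      by metis
    then show ?thesis
      using simplicial_resolution[OF G(1) inj, of H \<beta> B] img xs(1) v(2) x1 H_def by metis
  qed
qed

theorem theorem4p3:
  fixes G :: "'v::finite graph" and x :: "nat \<Rightarrow> 'v" and H :: "nat \<Rightarrow> 'v graph"
    and r i :: nat
  assumes "simple_graph G" and "chordal G"
    and "x 1 \<in> verts G"
    and "inj_on x {1..r}" and "closed_nbhd G (x 1) = x ` {1..r}"
    and "is_clique G (closed_nbhd G (x 1))"
    and "\<And>t. t \<in> {1..r} \<Longrightarrow> H t = remove_verts G (closed_nbhd G (x t))"
    and "i \<ge> 1"
  shows "betti (cover_ideal G :: ('v, 'k::field) mpoly set) i =
      (\<Sum>t = 1..r. betti (cover_ideal (H t) :: ('v, 'k) mpoly set) i) +
      (\<Sum>t = 2..r. betti (cover_ideal (H t) :: ('v, 'k) mpoly set) (i - 1))"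
proof -
  have H: "simple_graph (H t)" "chordal (H t)" if "t \<in> {1..r}" for t
    using assms(1,2,7) that by (simp_all add: simple_graph_remove_verts chordal_remove_verts)
  have "\<exists>\<beta> B. minimal_graded_free_resolution (mono_ideal (cov (H t)) :: ('v, 'k) mpoly set) \<beta> B"
    if "t \<in> {1..r}" for t
    using chordal_resolution_exists H[OF that] by blast
  then obtain \<beta> B where B: "\<And>t. t \<in> {1..r} \<Longrightarrow>
      minimal_graded_free_resolution (mono_ideal (cov (H t)) :: ('v, 'k) mpoly set) (\<beta> t) (B t)"
    by metis
  obtain \<delta> D where D: "minimal_graded_free_resolution (mono_ideal (cov G) :: ('v, 'k) mpoly set) \<delta> D"
    "\<And>i. length (\<delta> i) = (\<Sum>t = 1..r. length (\<beta> t i)) +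
        (\<Sum>t = 2..r. case i of 0 \<Rightarrow> 0 | Suc j \<Rightarrow> length (\<beta> t j))"
    using simplicial_resolution[OF assms(1,4,5,6,7) B] by blast
  have "betti (cover_ideal (H t) :: ('v, 'k) mpoly set) j = length (\<beta> t j)" if "t \<in> {1..r}" for t j
    using betti_eq_length[OF B[OF that]] cover_ideal_eq[OF H(1)[OF that]] by metis
  moreover have "betti (cover_ideal G :: ('v, 'k) mpoly set) i = length (\<delta> i)"
    using betti_eq_length[OF D(1)] cover_ideal_eq[OF assms(1)] by metis
  \<comment> \<open>Here \<open>i \<ge> 1\<close> enters: it turns the \<open>case\<close> into the
    summand for \<open>i - 1\<close>.\<close>
  moreover obtain j where "i = Suc j" using assms(8) by (cases i) auto
  ultimately show ?thesis by (simp add: D(2))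
qed

end
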